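(* Let $D\geq2$ and let $f:\mathbb C\to\mathbb C$ be a unicritical polynomial of degree $D$ with periodic critical point. If $\lambda$ is an eigenvalue of $f_*:\mathcal Q(\widehat{\mathbb C})\to\mathcal Q(\widehat{\mathbb C})$, then $D\lambda$ is an algebraic unit and $\frac1{4D}<|\lambda|<1$.
   Context: A polynomial $\mathbb C\to\mathbb C$ is unicritical if it has a unique critical point in $\mathbb C$; it is regarded as a rational map of the Riemann sphere $\widehat{\mathbb C}$. "Periodic critical point" means this critical point in $\mathbb C$ is periodic under $f$. A meromorphic quadratic differential on $\widehat{\mathbb C}$ is $\mathbf q=q(z)\,(\mathrm dz)^2$ with $q$ a rational function (orders at $\infty$ are computed in the coordinate $w=1/z$, so $(\mathrm dz)^2$ has a pole of order $4$ at $\infty$). $\mathcal Q(\widehat{\mathbb C})$ is the complex vector space of meromorphic quadratic differentials on $\widehat{\mathbb C}$ with at worst simple poles. The pushforward operator is $f_*\mathbf q=r\,(\mathrm dz)^2$ with $r(y)=\sum_{x\in f^{-1}(y)}\frac{q(x)}{f'(x)^2}$ (for generic $y$; this extends to a meromorphic quadratic differential); it maps $\mathcal Q(\widehat{\mathbb C})$ to itself. An eigenvalue is a scalar for which there is a nonzero eigenvector. An algebraic unit is a unit of the ring of algebraic integers.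
   Formalization: The eigenvalue λ is assumed to be nonzero: 0 is always an eigenvalue of f_* on the infinite-dimensional space Q (e.g. f = z²−1, q = (dz)²/(z(z²−1)) lies in the kernel), and the conclusion fails for λ = 0. *)

theory Defs
  imports
    "HOL-Computational_Algebra.Computational_Algebra"
    "HOL-Computational_Algebra.Field_as_Ring"
begin

section \<open>Rational functions and quadratic differentials on the Riemann sphere\<close>

text \<open>
  A meromorphic quadratic differential $q(z)\,(dz)^2$ on the sphere is represented by its
  coefficient, the rational function \<open>q\<close>, an element of the field of fractions of the
  polynomial ring. Its values and orders are read off from the representation in lowest
  terms.
\<close>

definition rat_num :: "complex poly fract \<Rightarrow> complex poly" where
  "rat_num q = fst (quot_of_fract q)"

definition rat_den :: "complex poly fract \<Rightarrow> complex poly" where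
  "rat_den q = snd (quot_of_fract q)"

text \<open>At a pole the following is 0, by the convention for division by zero.\<close>

definition rat_eval :: "complex poly fract \<Rightarrow> complex \<Rightarrow> complex" where
  "rat_eval q z = poly (rat_num q) z / poly (rat_den q) z"

text \<open>The two orders below are meaningful for \<open>q \<noteq> 0\<close> only.\<close>

definition qd_order :: "complex poly fract \<Rightarrow> complex \<Rightarrow> int" where
  "qd_order q z = int (order z (rat_num q)) - int (order z (rat_den q))"

text \<open>
  In the coordinate $w = 1/z$ one has $(dz)^2 = w^{-4}(dw)^2$, so the order at infinity of the
  differential is that of the function \<open>q\<close>, lowered by 4.
\<close>

definition qd_order_infinity :: "complex poly fract \<Rightarrow> int" where
  "qd_order_infinity q = int (degree (rat_den q)) - int (degree (rat_num q)) - 4"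

definition quad_diffs :: "complex poly fract set" where
  "quad_diffs = {q. q = 0 \<or> ((\<forall>z. qd_order q z \<ge> -1) \<and> qd_order_infinity q \<ge> -1)}"

definition qd_scale :: "complex \<Rightarrow> complex poly fract \<Rightarrow> complex poly fract" where
  "qd_scale c q = to_fract [:c:] * q"


section \<open>The pushforward operator\<close>

text \<open>
  For nonconstant \<open>f\<close> there is exactly one rational function as described here; this is
  proved in \<open>pushforward_unique\<close> and \<open>pushforward_exists\<close> below.
\<close>

definition pushforward :: "complex poly \<Rightarrow> complex poly fract \<Rightarrow> complex poly fract" where
  "pushforward f q = (THE r. \<forall>\<^sub>F y in cofinite.
     rat_eval r y = (\<Sum>x | poly f x = y. rat_eval q x / (poly (pderiv f) x)\<^sup>2))"

definition pushforward_eigenvalue :: "complex poly \<Rightarrow> complex \<Rightarrow> bool" where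
  "pushforward_eigenvalue f \<mu> \<longleftrightarrow>
     (\<exists>q\<in>quad_diffs. q \<noteq> 0 \<and> pushforward f q = qd_scale \<mu> q)"


section \<open>Unicritical polynomials and algebraic units\<close>

definition unicritical :: "complex poly \<Rightarrow> bool" where
  "unicritical f \<longleftrightarrow> (\<exists>!c. poly (pderiv f) c = 0)"

definition periodic_point :: "('a \<Rightarrow> 'a) \<Rightarrow> 'a \<Rightarrow> bool" where
  "periodic_point g x \<longleftrightarrow> (\<exists>n>0. (g ^^ n) x = x)"

definition algebraic_unit :: "complex \<Rightarrow> bool" where
  "algebraic_unit x \<longleftrightarrow> algebraic_int x \<and> (\<exists>y. algebraic_int y \<and> x * y = 1)"


section \<open>The pushforward is well defined\<close>

lemma rat_den_nonzero [simp]: "rat_den q \<noteq> 0"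
  by (simp add: rat_den_def)

lemma Fract_rat_num_den: "Fract (rat_num q) (rat_den q) = q"
  using quot_to_fract_quot_of_fract[of q]
  by (simp add: quot_to_fract_def rat_num_def rat_den_def case_prod_unfold)

lemma coprime_rat_num_den: "coprime (rat_num q) (rat_den q)"
  by (simp add: rat_num_def rat_den_def coprime_quot_of_fract)

lemma rat_cross:
  assumes "b \<noteq> 0"
  shows "rat_num (Fract a b) * b = a * rat_den (Fract a b)"
proof -
  have "Fract (rat_num (Fract a b)) (rat_den (Fract a b)) = Fract a b"
    by (rule Fract_rat_num_den)
  thus ?thesis using assms by (simp add: eq_fract)
qed

lemma rat_eval_Fract:
  assumes "poly b z \<noteq> 0"
  shows "rat_eval (Fract a b) z = poly a z / poly b z"
proof -
  have b: "b \<noteq> 0" using assms by auto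
  let ?n = "rat_num (Fract a b)" and ?d = "rat_den (Fract a b)"
  have eq: "?n * b = a * ?d" by (rule rat_cross[OF b])
  have "?d dvd ?n * b" by (simp add: eq)
  hence "?d dvd b"
    using coprime_rat_num_den[of "Fract a b"]
    by (simp add: coprime_commute coprime_dvd_mult_right_iff)
  hence "poly ?d z \<noteq> 0" using assms by (metis dvdE mult_zero_left poly_mult)
  moreover have "poly ?n z * poly b z = poly a z * poly ?d z"
    using arg_cong[OF eq, of "\<lambda>p. poly p z"] by simp
  ultimately show ?thesis using assms by (simp add: rat_eval_def field_simps)
qed

lemma eventually_poly_nonzero:
  fixes p :: "complex poly"
  assumes "p \<noteq> 0"
  shows "\<forall>\<^sub>F z in cofinite. poly p z \<noteq> 0"
  using poly_roots_finite[OF assms] by (simp add: eventually_cofinite)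

lemma rat_eval_unique:
  assumes "\<forall>\<^sub>F z in cofinite. rat_eval r z = rat_eval s z"
  shows "r = s"
proof -
  let ?p = "rat_num r * rat_den s - rat_num s * rat_den r"
  have "\<forall>\<^sub>F z in cofinite. poly ?p z = 0"
    using assms eventually_poly_nonzero[OF rat_den_nonzero[of r]]
      eventually_poly_nonzero[OF rat_den_nonzero[of s]]
    by eventually_elim (simp add: rat_eval_def field_simps)
  have "?p = 0"
  proof (rule ccontr)
    assume "?p \<noteq> 0"
    from eventually_poly_nonzero[OF this] \<open>\<forall>\<^sub>F z in cofinite. poly ?p z = 0\<close>
    have "\<forall>\<^sub>F z::complex in cofinite. False"
      by eventually_elim blast
    thus False by (simp add: eventually_cofinite infinite_UNIV_char_0)
  qed
  hence "Fract (rat_num r) (rat_den r) = Fract (rat_num s) (rat_den s)"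
    by (simp add: eq_fract)
  thus ?thesis by (simp add: Fract_rat_num_den)
qed

lemma eventually_fibre:
  fixes f :: "complex poly"
  assumes "\<forall>\<^sub>F x in cofinite. P x"
  shows "\<forall>\<^sub>F y in cofinite. \<forall>x. poly f x = y \<longrightarrow> P x"
proof -
  have "{y. \<not> (\<forall>x. poly f x = y \<longrightarrow> P x)} \<subseteq> poly f ` {x. \<not> P x}" by auto
  moreover have "finite (poly f ` {x. \<not> P x})"
    using assms by (simp add: eventually_cofinite)
  ultimately show ?thesis unfolding eventually_cofinite by (rule finite_subset)
qed

text \<open>Lagrange interpolation at the points of a fibre without critical points.\<close>

lemma fibre_sum_low_degree:
  fixes f h :: "complex poly"
  assumes deg: "degree h < degree f"
    and y: "\<And>x. poly f x = y \<Longrightarrow> poly (pderiv f) x \<noteq> 0"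
  shows "(\<Sum>x | poly f x = y. poly h x / poly (pderiv f) x)
           = coeff h (degree f - 1) / lead_coeff f"
proof -
  define X where "X = {x. poly f x = y}"
  define g where "g = f - [:y:]"
  have degg: "degree g = degree f"
    unfolding g_def diff_conv_add_uminus by (rule degree_add_eq_left) (use deg in auto)
  have lcg: "lead_coeff g = lead_coeff f"
    using deg unfolding degg by (auto simp: g_def coeff_pCons split: nat.splits)
  have pdg: "pderiv g = pderiv f" by (simp add: g_def pderiv_diff pderiv_pCons)
  have X: "X = {x. poly g x = 0}" by (auto simp: X_def g_def)
  have g0: "g \<noteq> 0" using deg degg by auto
  have finX: "finite X" unfolding X using g0 by (rule poly_roots_finite)
  have "rsquarefree g"
    unfolding rsquarefree_roots pdg using y by (auto simp: g_def)
  hence dec: "smult (lead_coeff f) (\<Prod>x\<in>X. [:-x, 1:]) = g"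
    using complex_poly_decompose_rsquarefree[of g] lcg by (simp add: X)
  have lc0: "lead_coeff f \<noteq> 0" using deg by auto
  have cardX: "card X = degree f"
  proof -
    have "degree g = degree (\<Prod>x\<in>X. [:-x, 1:])"
      using lc0 by (subst dec[symmetric]) simp
    also have "\<dots> = (\<Sum>x\<in>X. degree [:-x, 1:])"
      by (rule degree_prod_eq_sum_degree) auto
    finally show ?thesis using degg by simp
  qed
  define L where "L = (\<lambda>x. smult (lead_coeff f) (\<Prod>x'\<in>X - {x}. [:-x', 1:]))"
  have degM: "degree (\<Prod>x'\<in>X - {x}. [:-x', 1:]) = degree f - 1" if "x \<in> X" for x
  proof -
    have "degree (\<Prod>x'\<in>X - {x}. [:-x', 1:]) = (\<Sum>x'\<in>X - {x}. degree [:-x', 1:])"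
      by (rule degree_prod_eq_sum_degree) auto
    thus ?thesis using that finX cardX by simp
  qed
  have degL: "degree (L x) = degree f - 1" if "x \<in> X" for x
    using degM[OF that] lc0 by (simp add: L_def)
  have monic: "lead_coeff (\<Prod>x'\<in>A. [:-x', 1:]) = 1" for A :: "complex set"
    by (simp add: lead_coeff_prod)
  have coeffL: "coeff (L x) (degree f - 1) = lead_coeff f" if "x \<in> X" for x
    using monic[of "X - {x}"] degM[OF that] by (simp add: L_def)
  have gL: "g = [:-x, 1:] * L x" if "x \<in> X" for x
  proof -
    have "(\<Prod>x\<in>X. [:-x, 1:]) = [:-x, 1:] * (\<Prod>x'\<in>X - {x}. [:-x', 1:])"
      by (rule prod.remove[OF finX that])
    thus ?thesis by (simp only: L_def dec[symmetric] mult_smult_right)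
  qed
  have Lx: "poly (L x) x = poly (pderiv f) x" if "x \<in> X" for x
  proof -
    have "pderiv f = pderiv ([:-x, 1:] * L x)" using pdg gL[OF that] by simp
    also have "poly \<dots> x = poly (L x) x"
      by (simp only: pderiv_mult) (simp add: pderiv_pCons)
    finally show ?thesis by simp
  qed
  have Lx': "poly (L x) x' = 0" if "x \<in> X" "x' \<in> X" "x' \<noteq> x" for x x'
    using that finX by (simp add: L_def poly_prod)
  define I where "I = (\<Sum>x\<in>X. smult (poly h x / poly (pderiv f) x) (L x))"
  have "h = I"
  proof (rule poly_eqI_degree)
    fix z assume z: "z \<in> X"
    have "poly I z = (\<Sum>x\<in>X. poly h x / poly (pderiv f) x * poly (L x) z)"
      by (simp add: I_def poly_sum)
    also have "\<dots> = (\<Sum>x\<in>X. if x = z then poly h z else 0)"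
      by (rule sum.cong) (use z Lx Lx' y X_def in auto)
    also have "\<dots> = poly h z" using z finX by simp
    finally show "poly h z = poly I z" ..
  next
    show "degree h < card X" using deg cardX by simp
    have "degree I \<le> degree f - 1" unfolding I_def
      by (rule degree_sum_le[OF finX]) (metis degL degree_smult_le)
    thus "degree I < card X" using deg cardX by simp
  qed
  have "coeff I (degree f - 1)
      = (\<Sum>x\<in>X. poly h x / poly (pderiv f) x * coeff (L x) (degree f - 1))"
    by (simp add: I_def coeff_sum)
  also have "\<dots> = (\<Sum>x\<in>X. poly h x / poly (pderiv f) x * lead_coeff f)"
    by (rule sum.cong) (simp_all only: coeffL)
  also have "\<dots> = (\<Sum>x\<in>X. poly h x / poly (pderiv f) x) * lead_coeff f"
    by (simp add: sum_distrib_right)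
  finally show ?thesis using lc0 \<open>h = I\<close>[symmetric] by (simp add: X_def)
qed

lemma fibre_sum_polynomial:
  fixes f h :: "complex poly"
  assumes f: "degree f > 0"
  shows "\<exists>R. \<forall>y. (\<forall>x. poly f x = y \<longrightarrow> poly (pderiv f) x \<noteq> 0) \<longrightarrow>
           (\<Sum>x | poly f x = y. poly h x / poly (pderiv f) x) = poly R y"
proof (induction "degree h" arbitrary: h rule: less_induct)
  case less
  show ?case
  proof (cases "degree h < degree f")
    case True
    show ?thesis
      by (rule exI[of _ "[:coeff h (degree f - 1) / lead_coeff f:]"])
        (use fibre_sum_low_degree[OF True] in auto)
  next
    case False
    define u v where "u = h div f" and "v = h mod f"
    have f0: "f \<noteq> 0" using f by auto
    have h: "h = f * u + v" by (simp add: u_def v_def)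
    have "degree v < degree f"
      using f f0 degree_mod_less[of f h] by (auto simp: v_def)
    moreover have "degree u < degree h"
      using False f by (simp add: u_def degree_div_less)
    moreover from calculation False have "degree v < degree h" by linarith
    ultimately obtain U V where
      U: "\<And>y. (\<forall>x. poly f x = y \<longrightarrow> poly (pderiv f) x \<noteq> 0) \<Longrightarrow>
           (\<Sum>x | poly f x = y. poly u x / poly (pderiv f) x) = poly U y" and
      V: "\<And>y. (\<forall>x. poly f x = y \<longrightarrow> poly (pderiv f) x \<noteq> 0) \<Longrightarrow>
           (\<Sum>x | poly f x = y. poly v x / poly (pderiv f) x) = poly V y"
      using less[of u] less[of v] by blast
    show ?thesis
    proof (rule exI[of _ "[:0, 1:] * U + V"], intro allI impI)
      fix y assume y: "\<forall>x. poly f x = y \<longrightarrow> poly (pderiv f) x \<noteq> 0"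
      have "(\<Sum>x | poly f x = y. poly h x / poly (pderiv f) x)
          = (\<Sum>x | poly f x = y. y * (poly u x / poly (pderiv f) x)
               + poly v x / poly (pderiv f) x)"
        by (rule sum.cong) (auto simp: h add_divide_distrib)
      also have "\<dots> = y * poly U y + poly V y"
        by (simp only: sum.distrib sum_distrib_left[symmetric] U[OF y] V[OF y])
      finally show "(\<Sum>x | poly f x = y. poly h x / poly (pderiv f) x)
          = poly ([:0, 1:] * U + V) y" by simp
    qed
  qed
qed

lemma dvd_pcompose_exists:
  fixes f b :: "complex poly"
  assumes "b \<noteq> 0"
  shows "\<exists>N. N \<noteq> 0 \<and> b dvd N \<circ>\<^sub>p f"
  using assms
proof (induction "degree b" arbitrary: b rule: less_induct)
  case less
  show ?case
  proof (cases "degree b = 0")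
    case True
    hence "b dvd 1" using less.prems by (metis is_unit_iff_degree)
    thus ?thesis by (intro exI[of _ 1]) (auto simp: pcompose_1)
  next
    case False
    then obtain \<beta> where "poly b \<beta> = 0"
      using fundamental_theorem_of_algebra[of b] by (auto simp: constant_degree)
    then obtain b' where b': "b = [:-\<beta>, 1:] * b'"
      by (metis poly_eq_0_iff_dvd dvdE)
    have b'0: "b' \<noteq> 0" using less.prems b' by auto
    have "degree b = Suc (degree b')" using b'0 unfolding b' by (subst degree_mult_eq) auto
    then obtain N where N: "N \<noteq> 0" "b' dvd N \<circ>\<^sub>p f" using less.hyps[of b'] b'0 by auto
    have "[:-\<beta>, 1:] dvd [:-poly f \<beta>, 1:] \<circ>\<^sub>p f"
      by (simp add: poly_eq_0_iff_dvd[symmetric] poly_pcompose)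
    hence "b dvd ([:-poly f \<beta>, 1:] * N) \<circ>\<^sub>p f"
      unfolding b' pcompose_mult using N(2) by (rule mult_dvd_mono)
    moreover have "[:-poly f \<beta>, 1:] * N \<noteq> 0"
      unfolding mult_eq_0_iff using N(1) by simp
    ultimately show ?thesis by blast
  qed
qed

theorem pushforward_exists:
  assumes f: "degree f > 0"
  shows "\<exists>r. \<forall>\<^sub>F y in cofinite.
     rat_eval r y = (\<Sum>x | poly f x = y. rat_eval q x / (poly (pderiv f) x)\<^sup>2)"
proof -
  define a b where "a = rat_num q" and "b = rat_den q"
  have f'0: "pderiv f \<noteq> 0" using f by (simp add: pderiv_eq_0_iff)
  have b0: "b \<noteq> 0" by (simp add: b_def)
  have B0: "b * pderiv f \<noteq> 0" using f'0 b0 by simp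
  obtain N where N: "N \<noteq> 0" "b * pderiv f dvd N \<circ>\<^sub>p f"
    using dvd_pcompose_exists[OF B0] by blast
  then obtain C where C: "N \<circ>\<^sub>p f = b * pderiv f * C" by (auto elim: dvdE)
  obtain R where R: "\<And>y. (\<forall>x. poly f x = y \<longrightarrow> poly (pderiv f) x \<noteq> 0) \<Longrightarrow>
           (\<Sum>x | poly f x = y. poly (a * C) x / poly (pderiv f) x) = poly R y"
    using fibre_sum_polynomial[OF f, of "a * C"] by blast
  show ?thesis
  proof (rule exI[of _ "Fract R N"])
    show "\<forall>\<^sub>F y in cofinite. rat_eval (Fract R N) y
        = (\<Sum>x | poly f x = y. rat_eval q x / (poly (pderiv f) x)\<^sup>2)"
      using eventually_poly_nonzero[OF N(1)]
        eventually_fibre[OF eventually_poly_nonzero[OF f'0], of f]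
    proof eventually_elim
      case (elim y)
      have "(\<Sum>x | poly f x = y. rat_eval q x / (poly (pderiv f) x)\<^sup>2)
          = (\<Sum>x | poly f x = y. poly (a * C) x / poly (pderiv f) x / poly N y)"
      proof (rule sum.cong)
        fix x assume "x \<in> {x. poly f x = y}"
        hence x: "poly f x = y" by simp
        have "poly N y = poly b x * poly (pderiv f) x * poly C x"
          using arg_cong[OF C, of "\<lambda>p. poly p x"] x by (simp add: poly_pcompose)
        thus "rat_eval q x / (poly (pderiv f) x)\<^sup>2
            = poly (a * C) x / poly (pderiv f) x / poly N y"
          using elim(1) by (simp add: rat_eval_def a_def b_def power2_eq_square)
      qed simp
      also have "\<dots> = poly R y / poly N y"
        using R[OF elim(2)] by (simp only: sum_divide_distrib[symmetric])
      finally show ?case using rat_eval_Fract[OF elim(1), of R] by simp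
    qed
  qed
qed

lemma pushforward_unique:
  assumes "\<forall>\<^sub>F y in cofinite.
     rat_eval r y = (\<Sum>x | poly f x = y. rat_eval q x / (poly (pderiv f) x)\<^sup>2)"
  shows "pushforward f q = r"
  unfolding pushforward_def
proof (rule the_equality)
  show "\<forall>\<^sub>F y in cofinite.
     rat_eval r y = (\<Sum>x | poly f x = y. rat_eval q x / (poly (pderiv f) x)\<^sup>2)"
    by (fact assms)
next
  fix s assume s: "\<forall>\<^sub>F y in cofinite.
     rat_eval s y = (\<Sum>x | poly f x = y. rat_eval q x / (poly (pderiv f) x)\<^sup>2)"
  show "s = r" by (rule rat_eval_unique) (use s assms in eventually_elim, simp)
qed

lemma pushforward_spec:
  assumes "degree f > 0"
  shows "\<forall>\<^sub>F y in cofinite. rat_eval (pushforward f q) y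
     = (\<Sum>x | poly f x = y. rat_eval q x / (poly (pderiv f) x)\<^sup>2)"
  using pushforward_exists[OF assms, of q] pushforward_unique by metis


section \<open>The pushforward always has a kernel\<close>

text \<open>
  The space of all differentials with at worst simple poles is infinite-dimensional, and the
  pushforward is not injective on it: if \<open>f\<close> is unicritical of degree \<open>D \<ge> 2\<close> with critical
  point \<open>c\<close>, then $(dz)^2 / ((z-c)((z-c)^D-1))$ is annihilated. Hence 0 is always an
  eigenvalue, and assertions such as \<open>D * \<mu>\<close> being a unit are about nonzero
  eigenvalues \<open>\<mu>\<close>.
\<close>

lemma unicritical_symmetry:
  fixes f :: "complex poly"
  assumes deg: "degree f \<ge> 2" and uni: "unicritical f" and c: "poly (pderiv f) c = 0"
    and \<zeta>: "\<zeta> ^ degree f = 1"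
  shows "poly f (c + \<zeta> * (x - c)) = poly f x"
    and "\<zeta> * poly (pderiv f) (c + \<zeta> * (x - c)) = poly (pderiv f) x"
proof -
  define k m where "k = lead_coeff (pderiv f)" and "m = order c (pderiv f)"
  have roots: "{z. poly (pderiv f) z = 0} = {c}"
    using uni c by (auto simp: unicritical_def)
  have dec: "pderiv f = smult k ([:-c, 1:] ^ m)"
    using complex_poly_decompose[of "pderiv f"]
    unfolding roots k_def[symmetric] by (simp add: m_def[symmetric])
  have "pderiv f \<noteq> 0" using deg by (simp add: pderiv_eq_0_iff)
  hence "k \<noteq> 0" by (simp add: k_def)
  hence "degree (pderiv f) = m"
    by (simp add: dec degree_power_eq)
  hence Suc_m: "Suc m = degree f" using deg by (simp add: degree_pderiv)
  have f': "poly (pderiv f) z = k * (z - c) ^ m" for z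
    by (simp add: dec poly_power)
  show deriv: "\<zeta> * poly (pderiv f) (c + \<zeta> * (x - c)) = poly (pderiv f) x" for x
    using \<zeta> by (simp add: f' power_mult_distrib Suc_m[symmetric] mult_ac)
  define h where "h = f \<circ>\<^sub>p [:c - \<zeta> * c, \<zeta>:]"
  have arg: "poly [:c - \<zeta> * c, \<zeta>:] z = c + \<zeta> * (z - c)" for z
    by (simp add: algebra_simps)
  have "poly (pderiv h) z = poly (pderiv f) z" for z
    using deriv[of z]
    by (simp add: h_def pderiv_pcompose poly_pcompose pderiv_pCons algebra_simps)
  hence "pderiv (h - f) = 0" by (simp add: pderiv_diff poly_eq_poly_eq_iff[symmetric] fun_eq_iff)
  hence "degree (h - f) = 0" by (simp add: pderiv_eq_0_iff)
  then obtain t where t: "h - f = [:t:]" by (rule degree_eq_zeroE)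
  have "poly (h - f) c = 0" by (simp add: h_def poly_pcompose)
  hence "h = f" using t by simp
  hence "poly h x = poly f x" by simp
  thus "poly f (c + \<zeta> * (x - c)) = poly f x"
    by (simp add: h_def poly_pcompose algebra_simps)
qed

theorem pushforward_eigenvalue_0:
  assumes deg: "degree f \<ge> 2" and uni: "unicritical f"
  shows "pushforward_eigenvalue f 0"
proof -
  obtain c where c: "poly (pderiv f) c = 0" using uni by (auto simp: unicritical_def)
  define D where "D = degree f"
  have D: "D \<ge> 2" using deg by (simp add: D_def)
  obtain \<zeta> :: complex where \<zeta>: "\<zeta> ^ D = 1" "\<zeta> \<noteq> 1"
  proof -
    have "\<not> {z::complex. z ^ D = 1} \<subseteq> {1}"
    proof
      assume "{z::complex. z ^ D = 1} \<subseteq> {1}"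
      hence "card {z::complex. z ^ D = 1} \<le> card {1::complex}" by (intro card_mono) auto
      thus False using D card_roots_unity_eq[of D] by simp
    qed
    thus ?thesis using that by blast
  qed
  have \<zeta>0: "\<zeta> \<noteq> 0" using \<zeta> D by (auto simp: power_0_left)
  define b where "b = [:-c, 1:] ^ Suc D - [:-c, 1:]"
  define q where "q = Fract 1 b"
  have poly_b: "poly b z = (z - c) ^ Suc D - (z - c)" for z
    by (simp add: b_def poly_power algebra_simps)
  have poly_b': "poly (pderiv b) z = of_nat (Suc D) * (z - c) ^ D - 1" for z
    by (simp add: b_def pderiv_diff pderiv_power_Suc pderiv_pCons poly_power
        del: power_Suc of_nat_Suc)
  have "degree ([:-c, 1:] ^ Suc D) = Suc D"
    by (simp add: degree_power_eq del: power_Suc)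
  hence degb: "degree b = Suc D"
    unfolding b_def diff_conv_add_uminus
    by (subst degree_add_eq_left) (use D in \<open>simp_all del: power_Suc\<close>)
  have b0: "b \<noteq> 0" using degb by auto
  have sqf: "rsquarefree b"
    unfolding rsquarefree_roots
  proof (intro allI notI)
    fix z assume "poly b z = 0 \<and> poly (pderiv b) z = 0"
    hence 1: "(z - c) * ((z - c) ^ D - 1) = 0" and 2: "of_nat (Suc D) * (z - c) ^ D = (1::complex)"
      by (auto simp: poly_b poly_b' algebra_simps)
    from 1 have "(z - c) ^ D = 0 \<or> (z - c) ^ D = 1"
      using D by (auto simp: power_0_left)
    thus False
    proof
      assume "(z - c) ^ D = 0"
      with 2 show False by (simp only: mult_zero_right zero_neq_one)
    next
      assume "(z - c) ^ D = 1"
      with 2 D show False by simp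
    qed
  qed
  have cross: "rat_num q * b = rat_den q"
    using rat_cross[OF b0, of 1] by (simp add: q_def)
  hence "is_unit (rat_num q)"
    using coprime_rat_num_den[of q] by (metis coprime_def dvd_refl dvd_triv_left)
  then obtain u where u: "rat_num q = [:u:]" "u \<noteq> 0"
    by (metis is_unit_poly_iff is_unit_iff_degree not_is_unit_0 pCons_0_0)
  have den: "rat_den q = smult u b" using cross u by simp
  have q0: "q \<noteq> 0" using b0 by (simp add: q_def Zero_fract_def eq_fract)
  have "q \<in> quad_diffs"
  proof -
    have "order z b \<le> 1" for z
      using sqf unfolding rsquarefree_def by (metis le_numeral_extra(4) zero_le)
    thus ?thesis
      using u D by (simp add: quad_diffs_def qd_order_def qd_order_infinity_def den
          order_smult order_0I degb)
  qed
  moreover have "pushforward f q = 0"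
  proof (rule pushforward_unique)
    have "\<forall>\<^sub>F y in cofinite. \<forall>x. poly f x = y \<longrightarrow> poly b x \<noteq> 0"
      by (intro eventually_fibre eventually_poly_nonzero b0)
    thus "\<forall>\<^sub>F y in cofinite. rat_eval 0 y
        = (\<Sum>x | poly f x = y. rat_eval q x / (poly (pderiv f) x)\<^sup>2)"
    proof eventually_elim
      case (elim y)
      define g where "g = (\<lambda>x. 1 / poly b x / (poly (pderiv f) x)\<^sup>2)"
      define \<phi> where "\<phi> = (\<lambda>x. c + \<zeta> * (x - c))"
      let ?X = "{x. poly f x = y}"
      have sum_g: "(\<Sum>x\<in>?X. rat_eval q x / (poly (pderiv f) x)\<^sup>2) = sum g ?X"
        by (rule sum.cong) (use elim in \<open>auto simp: q_def g_def rat_eval_Fract\<close>)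
      have sym: "poly f (\<phi> x) = poly f x" "poly (pderiv f) x = \<zeta> * poly (pderiv f) (\<phi> x)" for x
        using unicritical_symmetry[OF deg uni c, of \<zeta> x] \<zeta> by (auto simp: \<phi>_def D_def)
      have "poly b (\<phi> x) = \<zeta> * poly b x" for x
      proof -
        have "\<phi> x - c = \<zeta> * (x - c)" by (simp add: \<phi>_def)
        moreover have "(\<zeta> * (x - c)) ^ Suc D = \<zeta> * (x - c) ^ Suc D"
          using \<zeta>(1) by (simp add: power_mult_distrib)
        ultimately show ?thesis by (simp only: poly_b right_diff_distrib)
      qed
      hence g\<phi>: "g (\<phi> x) = \<zeta> * g x" for x
        using \<zeta>0 by (simp add: g_def sym(2)[of x] power2_eq_square)
      have "bij_betw \<phi> ?X ?X"
      proof (rule bij_betwI[where g = "\<lambda>x. c + (x - c) / \<zeta>"])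
        have "poly f (c + (x - c) / \<zeta>) = poly f x" for x
          using sym(1)[of "c + (x - c) / \<zeta>"] \<zeta>0 by (simp add: \<phi>_def)
        thus "(\<lambda>x. c + (x - c) / \<zeta>) \<in> ?X \<rightarrow> ?X" by auto
      qed (use sym \<zeta>0 in \<open>auto simp: \<phi>_def\<close>)
      hence "sum g ?X = (\<Sum>x\<in>?X. g (\<phi> x))" by (rule sum.reindex_bij_betw[symmetric])
      also have "\<dots> = \<zeta> * sum g ?X" by (simp only: g\<phi> sum_distrib_left[symmetric])
      finally have "sum g ?X = \<zeta> * sum g ?X" .
      hence "(1 - \<zeta>) * sum g ?X = 0"
        unfolding left_diff_distrib mult_1_left right_minus_eq .
      hence "sum g ?X = 0" using \<zeta>(2) by simp
      moreover have "rat_eval 0 y = 0" by (simp add: rat_eval_def rat_num_def)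
      ultimately show ?case by (simp add: sum_g)
    qed
  qed
  ultimately show ?thesis
    using q0 by (auto simp: pushforward_eigenvalue_def qd_scale_def)
qed

end

theory Submission
  imports Defs "Jordan_Normal_Form.Char_Poly" "HOL-Analysis.Analysis"
begin

text \<open>
  Write \<open>f z = A * (z - c) ^ D + v\<close>, so that \<open>f' x = D * u x\<close> with
  \<open>u x = A * (x - c) ^ (D - 1)\<close>. A differential with at worst simple poles is a finite sum of
  terms \<open>a x / (z - x)\<close>, and for \<open>x \<noteq> c\<close> the pushforward of \<open>1 / (z - x)\<close> is
  \<open>(1 / f' x) * (1 / (z - f x) - 1 / (z - v))\<close>, while that of \<open>1 / (z - c)\<close> vanishes
  (\<open>pushforward_simple_pole\<close>). Comparing residues therefore turns the eigenvalue equation into a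
  recursion for the residues \<open>a x\<close> along the orbits of \<open>f\<close> (\<open>residue_equation\<close>).

  If some pole lies off the orbit of \<open>c\<close>, then every such pole is the image of one of the same kind, so \<open>f\<close>
  permutes a finite nonempty set \<open>S\<close> of poles, and multiplying the recursion over \<open>S\<close> gives
  \<open>(D * \<mu>) ^ card S * (\<Prod>x\<in>S. u x) = 1\<close> (\<open>poles_off_critical_orbit\<close>). If all poles lie on the orbit
  \<open>w 0 = v, w 1, ..., w m = c\<close>, the recursion determines all residues from the first one, and the
  term at \<open>v\<close> says that their sum is zero; this is the equation
  \<open>(\<Sum>k\<le>m. t ^ k / (\<Prod>i<k. u (w i))) = 0\<close> for \<open>t = 1 / (D * \<mu>)\<close> (\<open>poles_on_critical_orbit\<close>).

  At periodic points other than \<open>c\<close> the number \<open>u x\<close> is an algebraic unit, and its modulus is at most 2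
  (\<open>unicritical_periodic_derivative\<close>): after an affine change of coordinate \<open>f\<close> is \<open>z ^ D + \<kappa>\<close> and
  \<open>u x\<close> is \<open>z ^ (D - 1)\<close>; here \<open>\<kappa>\<close> and the periodic points are algebraic integers, \<open>0\<close> being periodic
  makes the nonzero ones units, and points with a larger value of \<open>\<bar>u x\<bar>\<close> escape to infinity. In both cases it follows
  that \<open>D * \<mu>\<close> is a unit and that \<open>\<bar>D * \<mu>\<bar> > 1 / 4\<close>.

  For the upper bound \<open>\<bar>\<mu>\<bar> < 1\<close>, let \<open>q\<close> be the coefficient of the eigenvector and let \<open>W\<close> be a large disc,
  whose preimage lies in the disc of half the radius. The local inverses \<open>g\<close> of \<open>f\<close> are injective with
  disjoint images, and \<open>\<bar>q\<bar>\<close> is an area density, so the integral of \<open>\<bar>\<mu> * q\<bar>\<close> over \<open>W\<close> is at most the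
  integral of \<open>\<bar>q\<bar>\<close> over the preimage of \<open>W\<close>, which is strictly less than the integral of \<open>\<bar>q\<bar>\<close> over \<open>W\<close>
  (\<open>norm_less_one_of_L1_contraction\<close>). All these integrals are finite because \<open>1 / \<bar>z - x\<bar>\<close> is locally
  integrable in the plane.
\<close>

section \<open>The ring of algebraic integers\<close>

text \<open>
  The additive group generated by \<open>B\<close>. The inductive form makes closure properties easy
  inductions; explicit integer coefficients are needed only once, for a matrix.
\<close>

inductive_set int_span :: "complex set \<Rightarrow> complex set" for B where
  zero: "0 \<in> int_span B"
| add: "y \<in> int_span B \<Longrightarrow> b \<in> B \<Longrightarrow> y + b \<in> int_span B"
| diff: "y \<in> int_span B \<Longrightarrow> b \<in> B \<Longrightarrow> y - b \<in> int_span B"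

lemma int_span_superset: "b \<in> B \<Longrightarrow> b \<in> int_span B"
  using int_span.add[OF int_span.zero] by simp

lemma int_span_add:
  assumes "x \<in> int_span B" "y \<in> int_span B"
  shows "x + y \<in> int_span B"
  using assms(2,1)
proof (induction y rule: int_span.induct)
  case (add y b)
  thus ?case using int_span.add[of "x + y" B b] by (simp add: add.assoc)
next
  case (diff y b)
  thus ?case using int_span.diff[of "x + y" B b] by (simp add: add_diff_eq)
qed simp

lemma int_span_diff:
  assumes "x \<in> int_span B" "y \<in> int_span B"
  shows "x - y \<in> int_span B"
  using assms(2,1)
proof (induction y rule: int_span.induct)
  case (add y b)
  thus ?case using int_span.diff[of "x - y" B b] by (simp add: diff_diff_eq)
next
  case (diff y b)
  thus ?case using int_span.add[of "x - y" B b] by (simp add: diff_diff_eq2 diff_add_eq)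
qed simp

lemma int_span_sum: "(\<And>i. i \<in> I \<Longrightarrow> g i \<in> int_span B) \<Longrightarrow> sum g I \<in> int_span B"
  by (induction I rule: infinite_finite_induct) (auto intro: int_span.zero int_span_add)

lemma int_span_mult_left:
  assumes "y \<in> int_span B" "\<And>b. b \<in> B \<Longrightarrow> x * b \<in> int_span C"
  shows "x * y \<in> int_span C"
  using assms(1)
  by induction (auto simp: ring_distribs intro: int_span.zero int_span_add int_span_diff assms(2))

lemma int_span_coefficients:
  assumes "y \<in> int_span B" "finite B"
  obtains k where "y = (\<Sum>b\<in>B. of_int (k b) * b)"
proof -
  have "\<exists>k. y = (\<Sum>b\<in>B. of_int (k b) * b)"
    using assms(1)
  proof induction
    case zero
    show ?case by (rule exI[of _ "\<lambda>_. 0"]) simp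
  next
    case (add y b)
    then obtain k where "y = (\<Sum>b\<in>B. of_int (k b) * b)" by blast
    moreover have "(\<Sum>b'\<in>B. of_int ((k(b := k b + 1)) b') * b')
        = (\<Sum>b'\<in>B. of_int (k b') * b' + (if b' = b then b' else 0))"
      by (rule sum.cong) (auto simp: algebra_simps)
    ultimately show ?case
      using add.hyps assms(2) by (intro exI[of _ "k(b := k b + 1)"]) (simp only: sum.distrib sum.delta if_True)
  next
    case (diff y b)
    then obtain k where "y = (\<Sum>b\<in>B. of_int (k b) * b)" by blast
    moreover have "(\<Sum>b'\<in>B. of_int ((k(b := k b - 1)) b') * b')
        = (\<Sum>b'\<in>B. of_int (k b') * b' - (if b' = b then b' else 0))"
      by (rule sum.cong) (auto simp: algebra_simps)
    ultimately show ?case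
      using diff.hyps assms(2) by (intro exI[of _ "k(b := k b - 1)"]) (simp only: sum_subtractf sum.delta if_True)
  qed
  thus ?thesis using that by blast
qed

text \<open>
  The determinant trick: multiplication by \<open>x\<close> is given by an integer matrix on the generators,
  the vector of generators is an eigenvector for \<open>x\<close>, and the characteristic polynomial of an integer
  matrix is monic with integer coefficients.
\<close>

lemma algebraic_int_of_stable_span:
  assumes B: "finite B" "b0 \<in> B" "b0 \<noteq> 0"
    and stable: "\<And>b. b \<in> B \<Longrightarrow> x * b \<in> int_span B"
  shows "algebraic_int x"
proof -
  have "\<forall>b\<in>B. \<exists>k. x * b = (\<Sum>b'\<in>B. of_int (k b') * b')"
    using int_span_coefficients[OF stable B(1)] by metis
  then obtain k where k: "\<And>b. b \<in> B \<Longrightarrow> x * b = (\<Sum>b'\<in>B. of_int (k b b') * b')"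
    by metis
  obtain bs where bs: "set bs = B" "distinct bs" using finite_distinct_list[OF B(1)] by blast
  define n where "n = length bs"
  define M where "M = Matrix.mat n n (\<lambda>(i, j). k (bs ! i) (bs ! j))"
  define w where "w = Matrix.vec n (\<lambda>i. bs ! i)"
  have M: "M \<in> carrier_mat n n" by (simp add: M_def)
  let ?M = "map_mat of_int M :: complex Matrix.mat"
  have M': "?M \<in> carrier_mat n n" using M by simp
  have "?M *\<^sub>v w = x \<cdot>\<^sub>v w"
  proof (rule eq_vecI)
    fix i assume "i < dim_vec (x \<cdot>\<^sub>v w)"
    hence i: "i < n" by (simp add: w_def)
    have "vec_index (?M *\<^sub>v w) i = (\<Sum>j<n. of_int (k (bs ! i) (bs ! j)) * bs ! j)"
      using i by (simp add: M_def w_def scalar_prod_def atLeast0LessThan)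
    also have "\<dots> = (\<Sum>b\<in>B. of_int (k (bs ! i) b) * b)"
      using bij_betw_nth[OF bs(2) refl bs(1)[symmetric]]
      by (intro sum.reindex_bij_betw) (simp add: n_def)
    also have "\<dots> = x * bs ! i" using k[of "bs ! i"] i bs nth_mem[of i bs] by (simp add: n_def)
    finally show "vec_index (?M *\<^sub>v w) i = vec_index (x \<cdot>\<^sub>v w) i" using i by (simp add: w_def)
  qed (simp add: M_def w_def)
  moreover have "w \<noteq> 0\<^sub>v n"
  proof
    assume w: "w = 0\<^sub>v n"
    obtain i where "i < n" "bs ! i = b0" using B(2) bs by (metis in_set_conv_nth n_def)
    thus False using arg_cong[OF w, of "\<lambda>v. vec_index v i"] B(3) by (simp add: w_def)
  qed
  ultimately have "eigenvalue ?M x"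
    unfolding eigenvalue_def eigenvector_def using M' by (intro exI[of _ w]) (simp add: w_def)
  hence "poly (char_poly ?M) x = 0" using eigenvalue_root_char_poly[OF M'] by simp
  moreover have "char_poly ?M = map_poly of_int (char_poly M)"
    by (rule of_int_hom.char_poly_hom[OF M])
  moreover have "lead_coeff (char_poly M) = 1" using degree_monic_char_poly[OF M] by simp
  ultimately show ?thesis unfolding algebraic_int_altdef_ipoly by auto
qed

text \<open>
  A subring of the complex numbers that is finitely generated as an additive group. Its elements are
  algebraic integers, and any finite set of algebraic integers lies in such a ring; this is how sums
  and products are handled.
\<close>

definition finite_int_ring :: "complex set \<Rightarrow> bool" where
  "finite_int_ring R \<longleftrightarrow> 1 \<in> R \<and> (\<forall>x\<in>R. \<forall>y\<in>R. x * y \<in> R) \<and> (\<exists>B. finite B \<and> R = int_span B)"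

lemma finite_int_ring_algebraic_int:
  assumes R: "finite_int_ring R" and x: "x \<in> R"
  shows "algebraic_int x"
proof -
  obtain B where B: "finite B" "R = int_span B" using R by (auto simp: finite_int_ring_def)
  have "\<exists>b\<in>B. b \<noteq> 0"
  proof (rule ccontr)
    assume *: "\<not> (\<exists>b\<in>B. b \<noteq> 0)"
    have "y = 0" if "y \<in> int_span B" for y
      using that by induction (use * in auto)
    moreover have "1 \<in> int_span B" using R B(2) by (auto simp: finite_int_ring_def)
    ultimately have "(1::complex) = 0" by blast
    thus False by simp
  qed
  then obtain b0 where "b0 \<in> B" "b0 \<noteq> 0" by blast
  moreover have "x * b \<in> int_span B" if "b \<in> B" for b
    using that R x B(2) int_span_superset by (auto simp: finite_int_ring_def)
  ultimately show ?thesis using algebraic_int_of_stable_span[OF B(1)] by blast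
qed

lemma finite_int_ring_Ints: "finite_int_ring (int_span {1})"
  unfolding finite_int_ring_def
proof (intro conjI ballI exI[of _ "{1}"])
  show "1 \<in> int_span {1::complex}" by (simp add: int_span_superset)
  fix x y :: complex assume "x \<in> int_span {1}" "y \<in> int_span {1}"
  thus "x * y \<in> int_span {1}" by (intro int_span_mult_left[of y "{1}" x]) auto
qed auto

lemma finite_int_ring_of_int:
  assumes "finite_int_ring R"
  shows "of_int k \<in> R"
proof -
  obtain B where B: "R = int_span B" and 1: "1 \<in> R" using assms by (auto simp: finite_int_ring_def)
  show ?thesis
    by (induction k rule: int_induct[where k = 0])
       (use B 1 in \<open>auto intro: int_span.zero int_span_add int_span_diff\<close>)
qed

text \<open>
  If \<open>x\<close> is a root of a monic polynomial of degree \<open>e\<close> over \<open>R\<close>, then the products of generators of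
  \<open>R\<close> with \<open>1, x, ..., x ^ (e - 1)\<close> generate \<open>R[x]\<close>, since the polynomial rewrites \<open>x ^ e\<close> by lower powers.
\<close>

lemma finite_int_ring_adjoin:
  assumes R: "finite_int_ring R" and p: "\<And>i. coeff p i \<in> R" "lead_coeff p = 1" "poly p x = 0"
  obtains S where "finite_int_ring S" "R \<subseteq> S" "x \<in> S"
proof -
  obtain B where B: "finite B" "R = int_span B" and 1: "1 \<in> R"
    and Rmult: "\<And>a b. a \<in> R \<Longrightarrow> b \<in> R \<Longrightarrow> a * b \<in> R"
    using R by (auto simp: finite_int_ring_def)
  define e where "e = degree p"
  have e: "e > 0"
  proof (rule ccontr)
    assume "\<not> e > 0"
    then obtain a where "p = [:a:]" by (metis degree_eq_zeroE e_def neq0_conv)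
    thus False using p by simp
  qed
  define C where "C = (\<lambda>(b, i). b * x ^ i) ` (B \<times> {..<e})"
  define S where "S = int_span C"
  have CI: "b * x ^ i \<in> C" if "b \<in> B" "i < e" for b i using that by (auto simp: C_def)
  have low: "r * x ^ i \<in> S" if "r \<in> R" "i < e" for r i
    using that int_span_mult_left[of r B "x ^ i" C] CI int_span_superset[of _ C]
    by (simp add: S_def B(2) mult.commute)
  have "0 = (\<Sum>i\<le>e. coeff p i * x ^ i)" using p(3) by (simp add: poly_altdef e_def)
  also have "\<dots> = (\<Sum>i<e. coeff p i * x ^ i) + x ^ e"
    using p(2) by (simp add: lessThan_Suc_atMost[symmetric] e_def)
  finally have xe: "x ^ e = 0 - (\<Sum>i<e. coeff p i * x ^ i)" by (simp add: eq_neg_iff_add_eq_0 add.commute)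
  have top: "r * x ^ e \<in> S" if "r \<in> R" for r
  proof -
    have "r * x ^ e = 0 - (\<Sum>i<e. (r * coeff p i) * x ^ i)"
      unfolding xe by (simp add: sum_distrib_left mult.assoc)
    also have "\<dots> \<in> S" unfolding S_def
      using low Rmult[OF that p(1)] by (intro int_span_diff int_span.zero int_span_sum) (auto simp: S_def)
    finally show ?thesis .
  qed
  have xS: "x * y \<in> S" if "y \<in> S" for y
    unfolding S_def
  proof (rule int_span_mult_left)
    show "y \<in> int_span C" using that by (simp add: S_def)
    fix z assume "z \<in> C"
    then obtain b i where bi: "b \<in> B" "i < e" "z = b * x ^ i" by (auto simp: C_def)
    have "b \<in> R" using bi B(2) int_span_superset by blast
    hence "b * x ^ Suc i \<in> S" using low[of b "Suc i"] top[of b] bi(2) by (cases "Suc i = e") auto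
    thus "x * z \<in> int_span C" using bi by (simp add: S_def mult_ac)
  qed
  have all: "r * x ^ i \<in> S" if "r \<in> R" for r i
  proof (induction i)
    case 0 show ?case using low[OF that e] by simp
  next
    case (Suc i) show ?case using xS[OF Suc.IH] by (simp add: mult_ac)
  qed
  have "finite_int_ring S"
    unfolding finite_int_ring_def
  proof (intro conjI ballI exI[of _ C])
    show "1 \<in> S" using all[OF 1, of 0] by simp
    fix y z assume y: "y \<in> S" and z: "z \<in> S"
    have "b * x ^ i * y \<in> S" if "b \<in> B" "i < e" for b i
      unfolding S_def
    proof (rule int_span_mult_left)
      show "y \<in> int_span C" using y by (simp add: S_def)
      fix w assume "w \<in> C"
      then obtain b' j where w: "b' \<in> B" "w = b' * x ^ j" by (auto simp: C_def)
      have "b * b' \<in> R" using that w B(2) int_span_superset by (intro Rmult) blast+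
      from all[OF this, of "i + j"] show "b * x ^ i * w \<in> int_span C"
        by (simp add: w S_def power_add mult_ac)
    qed
    hence "y * w \<in> S" if "w \<in> C" for w using that by (auto simp: C_def mult_ac)
    thus "y * z \<in> S" using z int_span_mult_left[of z C y C] by (simp add: S_def)
  qed (use B(1) in \<open>auto simp: C_def S_def\<close>)
  moreover have "R \<subseteq> S" using all[of _ 0] by auto
  moreover have "x \<in> S" using all[OF 1, of 1] by simp
  ultimately show ?thesis using that by blast
qed

lemma algebraic_ints_in_finite_int_ring:
  assumes "finite F" "\<And>x. x \<in> F \<Longrightarrow> algebraic_int x"
  obtains R where "finite_int_ring R" "F \<subseteq> R"
proof -
  have "\<exists>R. finite_int_ring R \<and> F \<subseteq> R"
    using assms
  proof (induction F rule: finite_induct)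
    case empty
    show ?case using finite_int_ring_Ints by auto
  next
    case (insert x F)
    then obtain R where R: "finite_int_ring R" "F \<subseteq> R" by auto
    obtain p where p: "lead_coeff p = 1" "\<forall>i. coeff p i \<in> \<int>" "poly p x = 0"
      using insert.prems[of x] by (auto elim: algebraic_int.cases)
    have "coeff p i \<in> R" for i
      using p(2) finite_int_ring_of_int[OF R(1)] by (metis Ints_cases)
    then obtain S where "finite_int_ring S" "R \<subseteq> S" "x \<in> S"
      using finite_int_ring_adjoin[OF R(1) _ p(1,3)] by blast
    thus ?case using R by (intro exI[of _ S]) auto
  qed
  thus ?thesis using that by blast
qed

lemma algebraic_int_add:
  fixes x y :: complex
  assumes "algebraic_int x" "algebraic_int y"
  shows "algebraic_int (x + y)"
proof -
  obtain R where R: "finite_int_ring R" "{x, y} \<subseteq> R"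
    using algebraic_ints_in_finite_int_ring[of "{x, y}"] assms by blast
  hence "x + y \<in> R" by (auto simp: finite_int_ring_def intro: int_span_add)
  thus ?thesis using R finite_int_ring_algebraic_int by blast
qed

lemma algebraic_int_mult:
  fixes x y :: complex
  assumes "algebraic_int x" "algebraic_int y"
  shows "algebraic_int (x * y)"
proof -
  obtain R where R: "finite_int_ring R" "{x, y} \<subseteq> R"
    using algebraic_ints_in_finite_int_ring[of "{x, y}"] assms by blast
  hence "x * y \<in> R" by (auto simp: finite_int_ring_def)
  thus ?thesis using R finite_int_ring_algebraic_int by blast
qed

lemma algebraic_int_monic_root:
  fixes x :: complex
  assumes "\<And>i. algebraic_int (coeff p i)" "lead_coeff p = 1" "poly p x = 0"
  shows "algebraic_int x"
proof -
  obtain R where R: "finite_int_ring R" "coeff p ` {..degree p} \<subseteq> R"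
    using algebraic_ints_in_finite_int_ring[of "coeff p ` {..degree p}"] assms(1) by blast
  have "coeff p i \<in> R" for i
  proof (cases "i \<le> degree p")
    case False
    hence "coeff p i = of_int 0" by (simp add: coeff_eq_0)
    thus ?thesis using finite_int_ring_of_int[OF R(1), of 0] by simp
  qed (use R in auto)
  from finite_int_ring_adjoin[OF R(1) this assms(2,3)] obtain S where "finite_int_ring S" "x \<in> S"
    by blast
  thus ?thesis by (rule finite_int_ring_algebraic_int)
qed

lemma algebraic_int_1: "algebraic_int (1::complex)"
  by (rule int_imp_algebraic_int) auto

lemma algebraic_int_diff:
  fixes x y :: complex
  assumes "algebraic_int x" "algebraic_int y"
  shows "algebraic_int (x - y)"
  using algebraic_int_add[of x "- y"] assms by simp

lemma algebraic_int_sum: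
  fixes g :: "'a \<Rightarrow> complex"
  assumes "\<And>i. i \<in> I \<Longrightarrow> algebraic_int (g i)"
  shows "algebraic_int (sum g I)"
  using assms by (induction I rule: infinite_finite_induct) (auto intro: algebraic_int_add)

lemma algebraic_int_power: "algebraic_int (x::complex) \<Longrightarrow> algebraic_int (x ^ n)"
  by (induction n) (auto intro: algebraic_int_mult algebraic_int_1)

lemma algebraic_int_of_power:
  fixes x :: complex
  assumes "algebraic_int (x ^ n)" "n > 0"
  shows "algebraic_int x"
  using assms(1)
  by (rule algebraic_int_root[where p = "monom 1 n"])
     (use assms(2) in \<open>auto simp: poly_monom degree_monom_eq\<close>)

lemma algebraic_unit_mult:
  assumes "algebraic_unit x" "algebraic_unit y"
  shows "algebraic_unit (x * y)"
proof -
  obtain x' y' where "algebraic_int x" "algebraic_int x'" "x * x' = 1"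
      "algebraic_int y" "algebraic_int y'" "y * y' = 1"
    using assms by (auto simp: algebraic_unit_def)
  moreover from this have "x * y * (x' * y') = 1"
    by (metis mult.assoc mult.commute mult_1)
  ultimately show ?thesis unfolding algebraic_unit_def using algebraic_int_mult by blast
qed

lemma algebraic_unit_1: "algebraic_unit 1"
  using algebraic_int_1 by (auto simp: algebraic_unit_def)

lemma algebraic_unit_prod:
  assumes "\<And>i. i \<in> I \<Longrightarrow> algebraic_unit (g i)"
  shows "algebraic_unit (prod g I)"
  using assms
  by (induction I rule: infinite_finite_induct) (auto intro: algebraic_unit_mult algebraic_unit_1)

lemma algebraic_unit_iff_inverse:
  "algebraic_unit x \<longleftrightarrow> x \<noteq> 0 \<and> algebraic_int x \<and> algebraic_int (inverse x)"
  unfolding algebraic_unit_def by (metis inverse_unique mult_zero_left right_inverse zero_neq_one)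

lemma algebraic_unit_inverse: "algebraic_unit x \<Longrightarrow> algebraic_unit (inverse x)"
  by (simp add: algebraic_unit_iff_inverse)

lemma algebraic_unit_of_power:
  assumes "algebraic_unit (x ^ n)" "n > 0"
  shows "algebraic_unit x"
  using assms algebraic_int_of_power[of x n] algebraic_int_of_power[of "inverse x" n]
  by (auto simp: algebraic_unit_iff_inverse power_inverse)

section \<open>Periodic points of unicritical polynomials\<close>

lemma algebraic_int_monic_relation:
  fixes t :: complex
  assumes \<gamma>: "\<And>k. k < m \<Longrightarrow> algebraic_int (\<gamma> k)" and t: "t ^ m + (\<Sum>k<m. \<gamma> k * t ^ k) = 0"
  shows "algebraic_int t"
proof (rule algebraic_int_monic_root)
  define p where "p = monom 1 m + (\<Sum>k<m. monom (\<gamma> k) k)"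
  have coeff_p: "coeff p i = (if i = m then 1 else if i < m then \<gamma> i else 0)" for i
    by (auto simp: p_def coeff_sum)
  show "algebraic_int (coeff p i)" for i
    using \<gamma> by (auto simp: coeff_p intro: algebraic_int_1)
  have "degree p = m"
    by (intro antisym degree_le le_degree) (auto simp: coeff_p)
  thus "lead_coeff p = 1" by (simp add: coeff_p)
  show "poly p t = 0" using t by (simp add: p_def poly_sum poly_monom)
qed

lemma algebraic_int_coeff_mult:
  fixes p r :: "complex poly"
  assumes "\<And>i. algebraic_int (coeff p i)" "\<And>i. algebraic_int (coeff r i)"
  shows "algebraic_int (coeff (p * r) i)"
  unfolding coeff_mult using assms by (intro algebraic_int_sum algebraic_int_mult)

lemma algebraic_int_coeff_power:
  fixes p :: "complex poly"
  assumes "\<And>i. algebraic_int (coeff p i)"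
  shows "algebraic_int (coeff (p ^ n) i)"
proof (induction n arbitrary: i)
  case 0
  show ?case by (cases i) (auto simp: algebraic_int_1)
next
  case (Suc n)
  show ?case unfolding power_Suc by (intro algebraic_int_coeff_mult assms Suc)
qed

text \<open>
  Applied with \<open>s = \<kappa>\<close> this is the iterate of \<open>z ^ D + \<kappa>\<close> as a polynomial in \<open>z\<close>; applied with \<open>s\<close> the
  variable itself it is the orbit of the critical point as a polynomial in \<open>\<kappa>\<close>.
\<close>

lemma iterated_poly_monic:
  fixes s :: "complex poly"
  assumes D: "D \<ge> 2" and s: "degree s \<le> 1" "\<And>i. algebraic_int (coeff s i)"
    and r: "r = (\<lambda>k. ((\<lambda>p. p ^ D + s) ^^ k) [:0, 1:])"
  shows "lead_coeff (r k) = 1" "degree (r k) > k" "algebraic_int (coeff (r k) i)"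
proof -
  have "lead_coeff (r k) = 1 \<and> degree (r k) > k \<and> (\<forall>i. algebraic_int (coeff (r k) i))"
  proof (induction k)
    case 0
    show ?case by (auto simp: r coeff_pCons algebraic_int_1 split: nat.splits)
  next
    case (Suc k)
    have rS: "r (Suc k) = r k ^ D + s" by (simp add: r)
    have "degree (r k ^ D) = D * degree (r k)" using Suc.IH by (intro Polynomial.degree_power_eq) auto
    moreover have "D * degree (r k) \<ge> 2 * degree (r k)" using D by simp
    ultimately have deg: "degree (r k ^ D) > Suc k" using Suc.IH by linarith
    hence lt: "degree s < degree (r k ^ D)" using s(1) by linarith
    have "lead_coeff (r (Suc k)) = lead_coeff (r k ^ D)"
      unfolding rS using lt by (metis add.commute lead_coeff_add_le)
    moreover have "degree (r (Suc k)) = degree (r k ^ D)"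
      unfolding rS using lt by (rule degree_add_eq_left)
    ultimately show ?case using deg Suc.IH
      by (auto simp: rS lead_coeff_power intro!: algebraic_int_add algebraic_int_coeff_power s)
  qed
  thus "lead_coeff (r k) = 1" "degree (r k) > k" "algebraic_int (coeff (r k) i)" by auto
qed

lemma poly_iterated:
  "poly (((\<lambda>p. p ^ D + s) ^^ k) [:0, 1:]) x = ((\<lambda>z. z ^ D + poly s x) ^^ k) (x::complex)"
  by (induction k) auto

text \<open>
  The orbit of \<open>0\<close> starts with \<open>\<kappa>\<close>, so \<open>\<kappa>\<close> is a root of the monic integer polynomial that describes a
  later point of the orbit in terms of \<open>\<kappa>\<close>.
\<close>

lemma algebraic_int_center_parameter:
  fixes \<kappa> :: complex
  assumes D: "D \<ge> 2" and per: "periodic_point (\<lambda>z. z ^ D + \<kappa>) 0"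
  shows "algebraic_int \<kappa>"
proof -
  obtain n where n: "n > 0" "((\<lambda>z. z ^ D + \<kappa>) ^^ n) 0 = 0"
    using per by (auto simp: periodic_point_def)
  obtain m where m: "n = Suc m" using n(1) by (cases n) auto
  define r where "r = (\<lambda>k. ((\<lambda>p. p ^ D + [:0, 1:]) ^^ k) [:0, 1 :: complex:])"
  have s: "degree [:0, 1 :: complex:] \<le> 1" "algebraic_int (coeff [:0, 1 :: complex:] i)" for i
    by (auto simp: coeff_pCons algebraic_int_1 split: nat.splits)
  note monic = iterated_poly_monic[OF D s r_def]
  define F where "F = (\<lambda>z. z ^ D + \<kappa>)"
  have F0: "F 0 = \<kappa>" using D by (simp add: F_def power_0_left)
  have "poly (r m) \<kappa> = (F ^^ m) \<kappa>" by (simp add: r_def poly_iterated F_def)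
  also have "\<dots> = (F ^^ m) (F 0)" by (simp only: F0)
  also have "\<dots> = (F ^^ n) 0" by (simp add: m funpow_swap1)
  also have "\<dots> = 0" using n(2) by (simp add: F_def)
  finally show ?thesis using algebraic_int_monic_root[of "r m" \<kappa>] monic by simp
qed

lemma algebraic_int_periodic_point:
  fixes \<kappa> :: complex
  assumes D: "D \<ge> 2" and \<kappa>: "algebraic_int \<kappa>" and per: "periodic_point (\<lambda>z. z ^ D + \<kappa>) x"
  shows "algebraic_int x"
proof -
  obtain n where n: "n > 0" "((\<lambda>z. z ^ D + \<kappa>) ^^ n) x = x"
    using per by (auto simp: periodic_point_def)
  define r where "r = (\<lambda>k. ((\<lambda>p. p ^ D + [:\<kappa>:]) ^^ k) [:0, 1 :: complex:])"
  have s: "degree [:\<kappa>:] \<le> 1" "algebraic_int (coeff [:\<kappa>:] i)" for i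
    using \<kappa> by (auto simp: coeff_pCons split: nat.splits)
  note monic = iterated_poly_monic[OF D s r_def]
  (* The period is positive, so the iterate has degree at least 2 and subtracting x keeps it monic. *)
  have lt: "degree (- [:0, 1 :: complex:]) < degree (r n)" using monic(2)[of n] n(1) by simp
  show ?thesis
  proof (rule algebraic_int_monic_root)
    show "algebraic_int (coeff (r n - [:0, 1:]) i)" for i
      by (auto simp: coeff_pCons algebraic_int_1 split: nat.splits intro!: algebraic_int_diff monic)
    have "lead_coeff (r n - [:0, 1:]) = lead_coeff (r n)"
      using lt by (metis add.commute diff_conv_add_uminus lead_coeff_add_le)
    thus "lead_coeff (r n - [:0, 1:]) = 1" by (simp only: monic(1))
    show "poly (r n - [:0, 1:]) x = 0" using n(2) by (simp add: r_def poly_iterated)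
  qed
qed

text \<open>
  Modulo \<open>x ^ D\<close> the orbits of \<open>x\<close> and of \<open>0\<close> agree from the first step on. At a common period of both
  this reads \<open>x = x ^ D * K\<close> with an algebraic integer \<open>K\<close>, so \<open>K\<close> is the inverse of \<open>x ^ (D - 1)\<close>.
\<close>

lemma periodic_point_unit:
  fixes \<kappa> :: complex
  assumes D: "D \<ge> 2" and per0: "periodic_point (\<lambda>z. z ^ D + \<kappa>) 0"
    and per: "periodic_point (\<lambda>z. z ^ D + \<kappa>) x" and x: "x \<noteq> 0"
  shows "algebraic_unit (x ^ (D - 1))"
proof -
  define F where "F = (\<lambda>z. z ^ D + \<kappa>)"
  have \<kappa>: "algebraic_int \<kappa>" by (rule algebraic_int_center_parameter[OF D per0])
  have xint: "algebraic_int x" by (rule algebraic_int_periodic_point[OF D \<kappa> per])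
  have orbit0: "algebraic_int ((F ^^ k) 0)" for k
    by (induction k) (auto simp: F_def intro!: algebraic_int_add algebraic_int_power \<kappa>)
  have "\<exists>K. algebraic_int K \<and> (F ^^ Suc k) x = x ^ D * K + (F ^^ Suc k) 0" for k
  proof (induction k)
    case 0
    show ?case using D by (auto simp: F_def power_0_left intro!: exI[of _ 1] algebraic_int_1)
  next
    case (Suc k)
    then obtain K where K: "algebraic_int K" "(F ^^ Suc k) x = x ^ D * K + (F ^^ Suc k) 0" by blast
    define y z where "y = (F ^^ Suc k) x" and "z = (F ^^ Suc k) 0"
    define L where "L = (\<Sum>i<D. z ^ (D - Suc i) * y ^ i)"
    have yz: "algebraic_int y" "algebraic_int z"
      using K orbit0[of "Suc k"] xint unfolding y_def z_def
      by (auto intro!: algebraic_int_add algebraic_int_mult algebraic_int_power)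
    have "y - z = x ^ D * K" using K(2)[folded y_def z_def] by simp
    moreover have "y ^ D - z ^ D = (y - z) * L"
      unfolding L_def by (rule power_diff_sumr2)
    ultimately have "y ^ D - z ^ D = x ^ D * (K * L)" by (simp add: mult.assoc)
    hence "F y = x ^ D * (K * L) + F z" by (simp add: F_def diff_eq_eq)
    moreover have "algebraic_int (K * L)" unfolding L_def
      using K(1) yz by (intro algebraic_int_mult algebraic_int_sum algebraic_int_power)
    ultimately show ?case by (auto simp: y_def z_def)
  qed
  note split = this
  obtain n m where nm: "n > 0" "(F ^^ n) 0 = 0" "m > 0" "(F ^^ m) x = x"
    using per0 per by (auto simp: periodic_point_def F_def)
  have fixed: "(g ^^ (i * j)) w = w" if "(g ^^ j) w = w" for g i j and w :: complex
    using that by (induction i) (auto simp: funpow_add)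
  have "(F ^^ (m * n)) 0 = 0" "(F ^^ (m * n)) x = x"
    using fixed[of n F 0 m] fixed[of m F x n] nm by (simp_all add: mult.commute)
  moreover obtain k where "m * n = Suc k" using nm by (metis not0_implies_Suc mult_is_0 less_irrefl)
  ultimately obtain K where K: "algebraic_int K" "x = x ^ D * K" using split[of k] by auto
  have "x * (x ^ (D - 1) * K) = x * 1"
    using K(2) D by (simp add: mult.assoc[symmetric] flip: power_Suc)
  hence "x ^ (D - 1) * K = 1" using x by (metis mult_left_cancel)
  thus ?thesis using K(1) xint by (auto simp: algebraic_unit_def intro: algebraic_int_power)
qed

lemma escape_step:
  fixes \<kappa> x :: complex
  assumes D: "D \<ge> 2" and x: "norm x ^ (D - 1) > 2" "norm \<kappa> \<le> norm x"
  shows "norm (x ^ D + \<kappa>) > norm x"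
proof -
  have "norm x > 0" using x D by (cases "norm x = 0") (auto simp: power_0_left)
  hence "norm x * 2 < norm x * norm x ^ (D - 1)" using x by simp
  also have "norm x * norm x ^ (D - 1) = norm (x ^ D)"
    using D by (simp add: norm_power flip: power_Suc)
  also have "\<dots> \<le> norm (x ^ D + \<kappa>) + norm \<kappa>" by (metis add_diff_cancel norm_triangle_ineq4)
  finally show ?thesis using x by linarith
qed

text \<open>
  Under these bounds the modulus grows strictly along the orbit.
\<close>

lemma not_periodic_escape:
  fixes \<kappa> x :: complex
  assumes D: "D \<ge> 2" and x: "norm x ^ (D - 1) > 2" "norm \<kappa> \<le> norm x"
  shows "\<not> periodic_point (\<lambda>z. z ^ D + \<kappa>) x"
proof
  define F where "F = (\<lambda>z. z ^ D + \<kappa>)"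
  assume "periodic_point (\<lambda>z. z ^ D + \<kappa>) x"
  then obtain n where n: "n > 0" "(F ^^ n) x = x" by (auto simp: periodic_point_def F_def)
  have step: "norm (F y) > norm y" if "norm x \<le> norm y" for y
    unfolding F_def
  proof (rule escape_step[OF D])
    have "norm x ^ (D - 1) \<le> norm y ^ (D - 1)" using that by (intro power_mono) auto
    thus "norm y ^ (D - 1) > 2" using x(1) by linarith
    show "norm \<kappa> \<le> norm y" using that x(2) by linarith
  qed
  have ge: "norm x \<le> norm ((F ^^ k) x)" for k
    by (induction k) (use step in \<open>auto intro: order.trans less_imp_le\<close>)
  obtain m where m: "n = Suc m" using n(1) by (cases n) auto
  have "norm x \<le> norm ((F ^^ m) x)" by (rule ge)
  also have "\<dots> < norm ((F ^^ n) x)" using step[OF ge[of m]] by (simp add: m)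
  finally show False using n(2) by simp
qed

lemma periodic_point_image:
  assumes "periodic_point g x"
  shows "periodic_point g (g x)"
  using assms unfolding periodic_point_def by (metis funpow_swap1)

text \<open>
  The escape criterion applied to the critical value \<open>\<kappa>\<close>, which is periodic, bounds \<open>\<kappa>\<close>; this bound
  is what allows the criterion to be applied to \<open>x\<close>.
\<close>

lemma periodic_point_norm_le:
  fixes \<kappa> x :: complex
  assumes D: "D \<ge> 2" and per0: "periodic_point (\<lambda>z. z ^ D + \<kappa>) 0"
    and per: "periodic_point (\<lambda>z. z ^ D + \<kappa>) x"
  shows "norm x ^ (D - 1) \<le> 2"
proof (rule ccontr)
  assume "\<not> norm x ^ (D - 1) \<le> 2"
  hence x: "norm x ^ (D - 1) > 2" by simp
  have "periodic_point (\<lambda>z. z ^ D + \<kappa>) \<kappa>"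
    using periodic_point_image[OF per0] D by (simp add: power_0_left)
  hence "norm \<kappa> ^ (D - 1) \<le> 2" using not_periodic_escape[OF D, of \<kappa> \<kappa>] by (meson not_le order_refl)
  hence "norm \<kappa> ^ (D - 1) < norm x ^ (D - 1)" using x by linarith
  hence "norm \<kappa> < norm x" by (rule power_less_imp_less_base) simp
  thus False using not_periodic_escape[OF D x] per by simp
qed

text \<open>
  The coordinate \<open>b * (z - c)\<close> with \<open>b ^ (D - 1) = A\<close> conjugates the map to \<open>z ^ D + \<kappa>\<close> and takes
  \<open>A * (x - c) ^ (D - 1)\<close> to the \<open>(D - 1)\<close>-st power of the new coordinate of \<open>x\<close>.
\<close>

lemma unicritical_periodic_derivative:
  fixes A c v x :: complex
  assumes D: "D \<ge> 2" and A: "A \<noteq> 0" and f: "\<And>z. f z = A * (z - c) ^ D + v"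
    and perc: "periodic_point f c" and per: "periodic_point f x"
  shows "norm (A * (x - c) ^ (D - 1)) \<le> 2"
    and "x \<noteq> c \<Longrightarrow> algebraic_unit (A * (x - c) ^ (D - 1))"
proof -
  define b where "b = exp (Ln A / of_nat (D - 1))"
  have "b ^ (D - 1) = exp (of_nat (D - 1) * (Ln A / of_nat (D - 1)))"
    unfolding b_def by (rule exp_of_nat_mult[symmetric])
  hence b: "b ^ (D - 1) = A" using D A by simp
  have b0: "b \<noteq> 0" by (simp add: b_def)
  define \<kappa> where "\<kappa> = b * (v - c)"
  define \<phi> where "\<phi> = (\<lambda>z. b * (z - c))"
  have "b ^ D = b * A" using b D by (metis Suc_diff_1 Suc_1 le_eq_less_or_eq less_le_trans pos2 power_Suc)
  note bD = this
  have conj: "\<phi> (f z) = \<phi> z ^ D + \<kappa>" for z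
  proof -
    have "\<phi> (f z) = b * A * (z - c) ^ D + \<kappa>" by (simp add: \<phi>_def f \<kappa>_def algebra_simps)
    thus ?thesis by (simp add: \<phi>_def power_mult_distrib bD)
  qed
  have "\<phi> ((f ^^ k) z) = ((\<lambda>z. z ^ D + \<kappa>) ^^ k) (\<phi> z)" for k z
    by (induction k) (auto simp: conj)
  hence per_conj: "periodic_point (\<lambda>z. z ^ D + \<kappa>) (\<phi> z)" if "periodic_point f z" for z
    using that unfolding periodic_point_def by metis
  have per0: "periodic_point (\<lambda>z. z ^ D + \<kappa>) 0" using per_conj[OF perc] by (simp add: \<phi>_def)
  have eq: "A * (x - c) ^ (D - 1) = \<phi> x ^ (D - 1)" unfolding \<phi>_def power_mult_distrib b ..
  show "norm (A * (x - c) ^ (D - 1)) \<le> 2"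
    unfolding eq norm_power by (rule periodic_point_norm_le[OF D per0 per_conj[OF per]])
  show "algebraic_unit (A * (x - c) ^ (D - 1))" if "x \<noteq> c"
    unfolding eq by (rule periodic_point_unit[OF D per0 per_conj[OF per]]) (use that b0 in \<open>simp add: \<phi>_def\<close>)
qed

text \<open>
  Up to units the equation is monic in \<open>t\<close>, and its constant term is 1, so it is also monic in
  \<open>1 / t\<close>. If \<open>\<bar>t\<bar> \<ge> 4\<close>, each term of the sum would be at least twice as large as the preceding one, so the last
  term could not be cancelled by the others.
\<close>

lemma unit_series_root:
  fixes u :: "nat \<Rightarrow> complex" and t :: complex
  assumes unit: "\<And>k. k < m \<Longrightarrow> algebraic_unit (u k)" and le: "\<And>k. k < m \<Longrightarrow> norm (u k) \<le> 2"
    and t: "t \<noteq> 0" and root: "(\<Sum>k\<le>m. t ^ k / (\<Prod>i<k. u i)) = 0"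
  shows "algebraic_unit t" and "norm t < 4"
proof -
  define \<beta> where "\<beta> = (\<lambda>k. inverse (\<Prod>i<k. u i))"
  have \<beta>: "algebraic_unit (\<beta> k)" if "k \<le> m" for k
    unfolding \<beta>_def using that unit by (intro algebraic_unit_inverse algebraic_unit_prod) auto
  have sum0: "(\<Sum>k\<le>m. \<beta> k * t ^ k) = 0"
    using root by (simp add: \<beta>_def field_simps)
  have "algebraic_int t"
  proof (rule algebraic_int_monic_relation)
    show "algebraic_int (inverse (\<beta> m) * \<beta> k)" if "k < m" for k
      using \<beta>[of k] \<beta>[of m] that by (intro algebraic_int_mult) (auto simp: algebraic_unit_iff_inverse)
    have "t ^ m + (\<Sum>k<m. inverse (\<beta> m) * \<beta> k * t ^ k) = inverse (\<beta> m) * (\<Sum>k\<le>m. \<beta> k * t ^ k)"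
      using \<beta>[of m] by (simp add: algebraic_unit_iff_inverse lessThan_Suc_atMost[symmetric] 
          sum_distrib_left ring_distribs mult.assoc[symmetric])
    thus "t ^ m + (\<Sum>k<m. inverse (\<beta> m) * \<beta> k * t ^ k) = 0" by (simp add: sum0)
  qed
  moreover have "algebraic_int (inverse t)"
  proof (rule algebraic_int_monic_relation)
    show "algebraic_int (\<beta> (m - k))" if "k < m" for k
      using \<beta>[of "m - k"] by (simp add: algebraic_unit_def)
    have "0 = inverse t ^ m * (\<Sum>k\<le>m. \<beta> k * t ^ k)" by (simp add: sum0)
    also have "\<dots> = (\<Sum>k\<le>m. \<beta> k * inverse t ^ (m - k))"
      unfolding sum_distrib_left
    proof (rule sum.cong)
      fix k assume "k \<in> {..m}"
      hence "inverse t ^ m = inverse t ^ (m - k) * inverse t ^ k" by (simp flip: power_add)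
      thus "inverse t ^ m * (\<beta> k * t ^ k) = \<beta> k * inverse t ^ (m - k)"
        using t by (simp add: power_inverse field_simps)
    qed simp
    also have "\<dots> = (\<Sum>k\<le>m. \<beta> (m - k) * inverse t ^ k)"
      by (rule sum.reindex_bij_witness[of _ "\<lambda>k. m - k" "\<lambda>k. m - k"]) auto
    also have "\<dots> = inverse t ^ m + (\<Sum>k<m. \<beta> (m - k) * inverse t ^ k)"
      by (simp add: lessThan_Suc_atMost[symmetric] \<beta>_def)
    finally show "inverse t ^ m + (\<Sum>k<m. \<beta> (m - k) * inverse t ^ k) = 0" by simp
  qed
  ultimately show "algebraic_unit t" using t by (simp add: algebraic_unit_iff_inverse)
  show "norm t < 4"
  proof (rule ccontr)
    assume "\<not> norm t < 4"
    hence t4: "norm t \<ge> 4" by simp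
    define w where "w = (\<lambda>k. norm (\<beta> k * t ^ k))"
    have wS: "w (Suc k) \<ge> 2 * w k" if "k < m" for k
    proof -
      have u0: "norm (u k) > 0" using unit[OF that] by (simp add: algebraic_unit_iff_inverse)
      have "w (Suc k) = w k * (norm t / norm (u k))"
        by (simp add: w_def \<beta>_def norm_mult norm_inverse divide_inverse)
      moreover have "norm t / norm (u k) \<ge> 2"
        using le[OF that] t4 u0 by (simp add: le_divide_eq)
      moreover have "w k \<ge> 0" by (simp add: w_def)
      ultimately show ?thesis using mult_left_mono[of 2 "norm t / norm (u k)" "w k"] by simp
    qed
    have "(\<Sum>k<j. w k) < w j" if "j \<le> m" for j
      using that
    proof (induction j)
      case 0
      show ?case by (simp add: w_def \<beta>_def)
    next
      case (Suc j)
      thus ?case using wS[of j] by simp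
    qed
    hence "(\<Sum>k<m. w k) < w m" by simp
    moreover have "w m \<le> (\<Sum>k<m. w k)"
    proof -
      have "\<beta> m * t ^ m = - (\<Sum>k<m. \<beta> k * t ^ k)"
        using sum0 by (simp add: lessThan_Suc_atMost[symmetric] eq_neg_iff_add_eq_0 add.commute)
      thus ?thesis using norm_sum[of "\<lambda>k. \<beta> k * t ^ k" "{..<m}"] by (simp add: w_def)
    qed
    ultimately show False by simp
  qed
qed

section \<open>Area integrals in the complex plane\<close>

text \<open>
  The change of variables theorem is about the spaces \<open>real^'n\<close>. It is transported to the complex plane
  along this isometry, which maps boxes to boxes and balls to balls.
\<close>

definition complex_of_vec2 :: "real^2 \<Rightarrow> complex" where
  "complex_of_vec2 x = Complex (x $ 1) (x $ 2)"

definition vec2_of_complex :: "complex \<Rightarrow> real^2" where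
  "vec2_of_complex z = vector [Re z, Im z]"

lemma complex_of_vec2_of_complex [simp]: "complex_of_vec2 (vec2_of_complex z) = z"
  by (simp add: complex_of_vec2_def vec2_of_complex_def)

lemma vec2_of_complex_of_vec2 [simp]: "vec2_of_complex (complex_of_vec2 x) = x"
  by (simp add: complex_of_vec2_def vec2_of_complex_def vec_eq_iff forall_2)

lemma vec2_of_complex_nth [simp]: "vec2_of_complex z $ 1 = Re z" "vec2_of_complex z $ 2 = Im z"
  by (simp_all add: vec2_of_complex_def)

lemma Re_Im_complex_of_vec2 [simp]:
  "Re (complex_of_vec2 x) = x $ 1" "Im (complex_of_vec2 x) = x $ 2"
  by (simp_all add: complex_of_vec2_def)

lemma norm_complex_of_vec2: "norm (complex_of_vec2 x) = norm x"
  by (simp add: cmod_def norm_vec_def L2_set_def sum_2)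

lemma linear_complex_of_vec2: "linear complex_of_vec2"
  by (rule linearI) (simp_all add: complex_eq_iff)

lemma linear_vec2_of_complex: "linear vec2_of_complex"
  by (rule linearI) (simp_all add: vec_eq_iff forall_2)

lemma image_complex_of_vec2: "complex_of_vec2 ` X = vec2_of_complex -` X"
  by (auto simp: image_iff) (metis vec2_of_complex_of_vec2 complex_of_vec2_of_complex)+

lemma image_vec2_of_complex: "vec2_of_complex ` X = complex_of_vec2 -` X"
  by (auto simp: image_iff) (metis vec2_of_complex_of_vec2 complex_of_vec2_of_complex)+

lemma complex_of_vec2_cbox:
  "complex_of_vec2 ` cbox a b = cbox (complex_of_vec2 a) (complex_of_vec2 b)"
  by (auto simp: image_complex_of_vec2 in_cbox_complex_iff mem_box_cart forall_2)

lemma vec2_of_complex_cbox: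
  "vec2_of_complex ` cbox a b = cbox (vec2_of_complex a) (vec2_of_complex b)"
  by (auto simp: image_vec2_of_complex in_cbox_complex_iff mem_box_cart forall_2)

lemma content_complex_of_vec2:
  "content (complex_of_vec2 ` cbox a b) = content (cbox a b)"
proof (cases "cbox a b = {}")
  case False
  have "content (cbox a b) = (b $ 1 - a $ 1) * (b $ 2 - a $ 2)"
    using False by (simp add: content_cbox_cart UNIV_2)
  moreover have "cbox (complex_of_vec2 a) (complex_of_vec2 b) \<noteq> {}"
    using False complex_of_vec2_cbox[of a b] by auto
  ultimately show ?thesis
    by (simp add: complex_of_vec2_cbox content_cbox' Basis_complex_def inner_complex_def)
qed simp

lemma has_integral_complex_iff_vec2:
  fixes f :: "complex \<Rightarrow> 'b::banach"
  shows "(f has_integral i) S \<longleftrightarrow>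
    ((\<lambda>x. f (complex_of_vec2 x)) has_integral i) (vec2_of_complex ` S)"
proof -
  have box1: "((\<lambda>x. h (complex_of_vec2 x)) has_integral z) (cbox (vec2_of_complex a) (vec2_of_complex b))"
    if "(h has_integral z) (cbox a b)" for h :: "complex \<Rightarrow> 'b" and z a b
    using has_integral_twiddle[of 1 vec2_of_complex complex_of_vec2 h z a b] that
      linear_continuous_at[of complex_of_vec2] linear_complex_of_vec2
    by (auto simp: complex_of_vec2_cbox vec2_of_complex_cbox content_complex_of_vec2[unfolded complex_of_vec2_cbox]
        linear_conv_bounded_linear intro!: exI)
  have content2: "content (cbox (vec2_of_complex a) (vec2_of_complex b)) = content (cbox a b)" for a b
    using content_complex_of_vec2[of "vec2_of_complex a" "vec2_of_complex b"]
    by (simp add: complex_of_vec2_cbox)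
  have box2: "(h has_integral z) (cbox (complex_of_vec2 a) (complex_of_vec2 b))"
    if "((\<lambda>x. h (complex_of_vec2 x)) has_integral z) (cbox a b)" for h :: "complex \<Rightarrow> 'b" and z a b
    using has_integral_twiddle[of 1 complex_of_vec2 vec2_of_complex "\<lambda>x. h (complex_of_vec2 x)" z a b] that
      linear_continuous_at[of vec2_of_complex] linear_vec2_of_complex
    by (auto simp: complex_of_vec2_cbox vec2_of_complex_cbox content2
        linear_conv_bounded_linear intro!: exI)
  have box: "(h has_integral z) (cbox a b) \<longleftrightarrow>
      ((\<lambda>x. h (complex_of_vec2 x)) has_integral z) (cbox (vec2_of_complex a) (vec2_of_complex b))"
    for h :: "complex \<Rightarrow> 'b" and z a b
    using box1[of h z a b] box2[of h z "vec2_of_complex a" "vec2_of_complex b"] by auto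
  have ball: "ball 0 B \<subseteq> cbox (vec2_of_complex a) (vec2_of_complex b) \<longleftrightarrow> ball 0 B \<subseteq> cbox a b" for B a b
  proof -
    have "vec2_of_complex ` ball 0 B = ball 0 B"
      by (auto simp: image_vec2_of_complex norm_complex_of_vec2)
    moreover have "inj vec2_of_complex" by (metis injI complex_of_vec2_of_complex)
    ultimately show ?thesis
      by (metis inj_image_subset_iff vec2_of_complex_cbox)
  qed
  have restrict: "(if complex_of_vec2 x \<in> S then f (complex_of_vec2 x) else 0)
     = (if x \<in> vec2_of_complex ` S then f (complex_of_vec2 x) else 0)" for x
    by (simp add: image_vec2_of_complex)
  have all: "(\<forall>a b. P a b) \<longleftrightarrow> (\<forall>a b. P (vec2_of_complex a) (vec2_of_complex b))" for P
    by (metis vec2_of_complex_of_vec2)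
  show ?thesis
    unfolding has_integral'[of f] has_integral'[of "\<lambda>x. f (complex_of_vec2 x)"]
    by (subst all, simp only: ball box restrict)
qed

lemma absolutely_integrable_complex_iff_vec2:
  fixes f :: "complex \<Rightarrow> 'b::euclidean_space"
  shows "f absolutely_integrable_on S \<longleftrightarrow>
    (\<lambda>x. f (complex_of_vec2 x)) absolutely_integrable_on (vec2_of_complex ` S)"
  by (simp only: absolutely_integrable_on_def integrable_on_def
      has_integral_complex_iff_vec2[of f] has_integral_complex_iff_vec2[of "\<lambda>x. norm (f x)"])

lemma integral_complex_eq_vec2:
  fixes f :: "complex \<Rightarrow> 'b::banach"
  shows "integral (vec2_of_complex ` S) (\<lambda>x. f (complex_of_vec2 x)) = integral S f"
  by (simp only: integral_def integrable_on_def has_integral_complex_iff_vec2[of f])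

text \<open>
  The Jacobian determinant of a holomorphic function is the square of the modulus of its derivative.
\<close>

theorem holomorphic_change_of_variables:
  fixes f :: "complex \<Rightarrow> real" and g :: "complex \<Rightarrow> complex"
  assumes S: "open S"
    and deriv: "\<And>x. x \<in> S \<Longrightarrow> (g has_field_derivative g' x) (at x)"
    and inj: "inj_on g S"
  shows "(\<lambda>x. (norm (g' x))\<^sup>2 * f (g x)) absolutely_integrable_on S \<and>
           integral S (\<lambda>x. (norm (g' x))\<^sup>2 * f (g x)) = b
     \<longleftrightarrow> f absolutely_integrable_on (g ` S) \<and> integral (g ` S) f = b"
proof -
  let ?T = complex_of_vec2 and ?V = vec2_of_complex
  define G where "G = (\<lambda>x. ?V (g (?T x)))"
  define G' where "G' = (\<lambda>x h. ?V (g' (?T x) * ?T h))"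
  have bl: "bounded_linear ?T" "bounded_linear ?V"
    using linear_complex_of_vec2 linear_vec2_of_complex by (simp_all add: linear_conv_bounded_linear)
  have open_VS: "open (?V ` S)"
    unfolding image_vec2_of_complex
    by (intro open_vimage S linear_continuous_on bl)
  have der: "(G has_derivative G' x) (at x within ?V ` S)" if "x \<in> ?V ` S" for x
  proof -
    have "?T x \<in> S" using that by (simp add: image_vec2_of_complex)
    from deriv[OF this] have "(g has_derivative (*) (g' (?T x))) (at (?T x))"
      by (simp add: has_field_derivative_def)
    hence "((g \<circ> ?T) has_derivative ((*) (g' (?T x)) \<circ> ?T)) (at x)"
      by (intro diff_chain_at bounded_linear_imp_has_derivative bl)
    hence "((?V \<circ> (g \<circ> ?T)) has_derivative (?V \<circ> ((*) (g' (?T x)) \<circ> ?T))) (at x)"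
      by (rule diff_chain_at[OF _ bounded_linear_imp_has_derivative[OF bl(2)]])
    thus ?thesis by (auto simp: G_def G'_def o_def intro: has_derivative_at_withinI)
  qed
  have injG: "inj_on G (?V ` S)"
  proof (rule inj_onI)
    fix x y assume xy: "x \<in> ?V ` S" "y \<in> ?V ` S" "G x = G y"
    have "?T (G x) = ?T (G y)" using xy(3) by simp
    hence "g (?T x) = g (?T y)" by (simp add: G_def)
    moreover have "?T x \<in> S" "?T y \<in> S" using xy(1,2) by auto
    ultimately have "?T x = ?T y" by (rule inj_onD[OF inj])
    thus "x = y" by (metis vec2_of_complex_of_vec2)
  qed
  have meas: "?V ` S \<in> sets lebesgue" using open_VS by auto
  have main: "(\<lambda>x. \<bar>det (matrix (G' x))\<bar> *\<^sub>R (vec (f (?T (G x))) :: real^1)) absolutely_integrable_on ?V ` S \<and>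
           integral (?V ` S) (\<lambda>x. \<bar>det (matrix (G' x))\<bar> *\<^sub>R (vec (f (?T (G x))) :: real^1)) = vec b
     \<longleftrightarrow> (\<lambda>x. vec (f (?T x)) :: real^1) absolutely_integrable_on (G ` ?V ` S)
       \<and> integral (G ` ?V ` S) (\<lambda>x. vec (f (?T x))) = (vec b :: real^1)"
    using has_absolute_integral_change_of_variables[OF meas der injG, where f = "\<lambda>x. vec (f (?T x))" and b = "vec b"] .
  have det: "det (matrix (G' x)) = (norm (g' (?T x)))\<^sup>2" for x
    unfolding cmod_power2 by (simp add: det_2 matrix_def G'_def axis_def power2_eq_square)
  have im: "G ` ?V ` S = ?V ` g ` S"
    by (simp add: G_def image_image)
  have "?T (G x) = g (?T x)" for x by (simp add: G_def)
  with main show ?thesis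
    unfolding det im
    by (simp add: absolutely_integrable_on_1_iff integral_on_1_eq
        absolutely_integrable_complex_iff_vec2 integral_complex_eq_vec2[symmetric])
qed


lemma negligible_complex_line:
  assumes "A \<noteq> 0"
  shows "negligible {y::complex. Im ((y - v) / A) = 0}"
proof -
  have "Im ((y - v) / A) = ((\<i> * A) \<bullet> y - (\<i> * A) \<bullet> v) / ((Re A)\<^sup>2 + (Im A)\<^sup>2)" for y
    by (simp add: Im_divide inner_complex_def diff_divide_distrib add_divide_distrib algebra_simps)
  moreover have "(Re A)\<^sup>2 + (Im A)\<^sup>2 \<noteq> 0" by (metis assms complex_neq_0 less_irrefl)
  ultimately have "{y. Im ((y - v) / A) = 0} = {y. (\<i> * A) \<bullet> y = (\<i> * A) \<bullet> v}" by auto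
  thus ?thesis using negligible_hyperplane[of "\<i> * A" "(\<i> * A) \<bullet> v"] assms by simp
qed

text \<open>
  Substituting \<open>z = a + w\<^sup>2\<close> with \<open>Re w > 0\<close> turns the integrand into the constant 4 on a bounded set;
  the substitution misses only a segment.
\<close>

lemma absolutely_integrable_inverse_norm:
  "(\<lambda>z::complex. 1 / norm (z - a)) absolutely_integrable_on ball a R"
proof -
  define S where "S = {w::complex. Re w > 0} \<inter> ((\<lambda>w. w\<^sup>2) -` ball 0 R)"
  define g where "g = (\<lambda>w. a + w\<^sup>2)"
  have "open S"
    unfolding S_def by (intro open_Int open_halfspace_Re_gt open_vimage open_ball continuous_intros)
  moreover have "bounded S"
  proof -
    have "norm w \<le> max 1 R" if "w \<in> S" for w
    proof (rule ccontr)
      assume "\<not> norm w \<le> max 1 R"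
      hence "norm w > 1" "norm w > R" by auto
      hence "norm w * norm w > norm w" using mult_strict_right_mono[of 1 "norm w" "norm w"] by linarith
      with \<open>norm w > R\<close> show False using that by (simp add: S_def norm_mult power2_eq_square)
    qed
    thus ?thesis unfolding bounded_iff by blast
  qed
  ultimately have S: "open S" "S \<in> lmeasurable" by (auto intro: lmeasurable_open)
  have inj: "inj_on g S"
    by (rule inj_onI) (auto simp: g_def S_def power2_eq_iff)
  have "(\<lambda>w. 4 :: real) absolutely_integrable_on S"
    using S(2) by (rule absolutely_integrable_on_const)
  moreover have eq4: "(norm (2 * w))\<^sup>2 * (1 / norm (g w - a)) = 4" if "w \<in> S" for w
    using that by (auto simp: g_def S_def norm_mult norm_power power_mult_distrib)
  ultimately have "(\<lambda>w. (norm (2 * w))\<^sup>2 * (1 / norm (g w - a))) absolutely_integrable_on S"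
    by (rule_tac absolutely_integrable_spike[where S = "{}"]) (use eq4 in auto)
  moreover have "(g has_field_derivative 2 * w) (at w)" for w
    unfolding g_def by (auto intro!: derivative_eq_intros)
  ultimately have int: "(\<lambda>z. 1 / norm (z - a)) absolutely_integrable_on g ` S"
    using holomorphic_change_of_variables[OF S(1) _ inj, of "\<lambda>w. 2 * w" "\<lambda>z. 1 / norm (z - a)"] by blast
  have sub: "g ` S \<subseteq> ball a R"
    by (auto simp: g_def S_def dist_norm)
  have "ball a R - g ` S \<subseteq> {y. Im ((y - a) / 1) = 0}"
  proof
    fix z assume z: "z \<in> ball a R - g ` S"
    define w where "w = csqrt (z - a)"
    have w: "w\<^sup>2 = z - a" by (simp add: w_def)
    have "\<not> Re w > 0"
    proof
      assume "Re w > 0"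
      hence "w \<in> S" using z w by (simp add: S_def dist_norm norm_minus_commute)
      hence "g w \<in> g ` S" by blast
      thus False using z w by (simp add: g_def)
    qed
    hence "Re w = 0" using csqrt_principal[of "z - a"] by (auto simp: w_def)
    hence "Im (w\<^sup>2) = 0" by (simp add: power2_eq_square)
    thus "z \<in> {y. Im ((y - a) / 1) = 0}" by (simp add: w)
  qed
  hence neg: "negligible (ball a R - g ` S)"
    by (rule negligible_subset[OF negligible_complex_line[of 1 a], rotated]) simp
  show ?thesis
  proof (rule absolutely_integrable_spike_set[OF int])
    have "{z \<in> g ` S - ball a R. 1 / norm (z - a) \<noteq> 0} = {}" using sub by blast
    thus "negligible {z \<in> g ` S - ball a R. 1 / norm (z - a) \<noteq> 0}"
      by (simp only: negligible_empty)
    show "negligible {z \<in> ball a R - g ` S. 1 / norm (z - a) \<noteq> 0}"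
      by (rule negligible_subset[OF neg]) blast
  qed
qed

section \<open>Contraction of the area norm\<close>

text \<open>
  Pushing forward does not increase the area norm: on a disc \<open>W\<close>, slit along a ray from \<open>v\<close>, the map
  \<open>z \<mapsto> A * (z - c) ^ D + v\<close> has \<open>D\<close> holomorphic inverse branches \<open>g j\<close>, and the integral of \<open>\<bar>g' j\<bar>\<^sup>2 * \<bar>q \<circ> g j\<bar>\<close> over
  the slit disc is that of \<open>\<bar>q\<bar>\<close> over the image of \<open>g j\<close>. These images are disjoint and stay inside a smaller
  disc, so an eigenvalue of modulus at least 1 would force \<open>q\<close> to vanish almost everywhere on the annulus
  between the two discs.
\<close>

lemma norm_less_one_of_L1_contraction:
  fixes q :: "complex \<Rightarrow> complex"
  assumes D: "D \<ge> 2" and A: "A \<noteq> 0"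
    and int: "\<And>R. (\<lambda>z. norm (q z)) absolutely_integrable_on ball c R"
    and eigen: "\<forall>\<^sub>F y in cofinite. \<mu> * q y =
        (\<Sum>x | A * (x - c) ^ D + v = y. q x / (of_nat D * A * (x - c) ^ (D - 1))\<^sup>2)"
    and nonzero: "\<forall>\<^sub>F z in cofinite. q z \<noteq> 0"
  shows "norm \<mu> < 1"
proof (rule ccontr)
  assume "\<not> norm \<mu> < 1"
  hence \<mu>: "norm \<mu> \<ge> 1" by simp
  define f where "f = (\<lambda>x. A * (x - c) ^ D + v)"
  define F where "F = (\<lambda>z. norm (q z))"
  (* The radius is chosen so that points at distance R/2 or more from c are mapped to distance R or more. *)
  define R where "R = max 2 (4 * (1 + norm (v - c)) / norm A)"
  have R: "R \<ge> 2" by (simp add: R_def)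
  have expand: "norm (f x - c) \<ge> R" if x: "norm (x - c) \<ge> R / 2" for x
  proof -
    have "norm (x - c) \<ge> 1" using x R by linarith
    hence "norm (x - c) ^ 2 \<le> norm (x - c) ^ D" by (rule power_increasing[OF D])
    moreover have "(R / 2) ^ 2 \<le> norm (x - c) ^ 2" using x R by (intro power_mono) auto
    ultimately have "(R / 2) ^ 2 \<le> norm (x - c) ^ D" by linarith
    hence 1: "norm A * (R / 2) ^ 2 \<le> norm (A * (x - c) ^ D)"
      by (simp add: norm_mult norm_power mult_left_mono)
    have "4 * (1 + norm (v - c)) / norm A \<le> R" by (simp add: R_def)
    hence "1 + norm (v - c) \<le> norm A * R / 4" using A by (simp add: field_simps)
    hence "R * (1 + norm (v - c)) \<le> R * (norm A * R / 4)" using R by (intro mult_left_mono) auto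
    moreover have "norm (v - c) \<le> R * norm (v - c)" using R mult_right_mono[of 1 R "norm (v - c)"] by simp
    ultimately have "R + norm (v - c) \<le> norm A * (R / 2) ^ 2"
      by (simp add: power2_eq_square algebra_simps)
    with 1 have "R + norm (v - c) \<le> norm (A * (x - c) ^ D)" by linarith
    also have "\<dots> \<le> norm (f x - c) + norm (v - c)"
      using norm_triangle_ineq4[of "f x - c" "v - c"] by (simp add: f_def)
    finally show ?thesis by simp
  qed
  define E where "E = {y. \<mu> * q y \<noteq>
        (\<Sum>x | A * (x - c) ^ D + v = y. q x / (of_nat D * A * (x - c) ^ (D - 1))\<^sup>2)}"
  have finE: "finite E" using eigen by (simp add: E_def eventually_cofinite)
  (* The disc of radius R without the branch cut of the inverse branches and without the finite set
     E on which the values of q may fail to satisfy the equation. *)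
  define W where "W = ball c R \<inter> {y. (y - v) / A \<notin> \<real>\<^sub>\<le>\<^sub>0} - E"
  have "open {y. (y - v) / A \<notin> \<real>\<^sub>\<le>\<^sub>0}"
  proof -
    have "open ((\<lambda>y. (y - v) / A) -` (- \<real>\<^sub>\<le>\<^sub>0))"
      by (intro open_vimage continuous_intros) (use A in \<open>auto simp: open_closed[symmetric]\<close>)
    thus ?thesis by (simp add: vimage_def)
  qed
  hence openW: "open W" unfolding W_def by (intro open_Diff open_Int open_ball finite_imp_closed finE)
  define \<rho> where "\<rho> = (\<lambda>y. exp (Ln ((y - v) / A) / of_nat D))"
  define \<zeta> where "\<zeta> = (\<lambda>j::nat. cis (2 * pi * real j / real D))"
  define g where "g = (\<lambda>j y. c + \<zeta> j * \<rho> y)"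
  define g' where "g' = (\<lambda>j y. \<zeta> j * \<rho> y / (of_nat D * (y - v)))"
  have \<zeta>: "\<zeta> j ^ D = 1" "\<zeta> j \<noteq> 0" for j
  proof -
    have "\<zeta> j ^ D = cis (real D * (2 * pi * real j / real D))"
      unfolding \<zeta>_def by (rule Complex.DeMoivre)
    also have "real D * (2 * pi * real j / real D) = 2 * pi * real j" using D by simp
    also have "cis (2 * pi * real j) = 1" by (rule cis_multiple_2pi) simp
    finally show "\<zeta> j ^ D = 1" .
    show "\<zeta> j \<noteq> 0" by (simp add: \<zeta>_def)
  qed
  have Wv: "y \<noteq> v" if "y \<in> W" for y using that by (auto simp: W_def)
  have \<rho>_pow: "A * \<rho> y ^ D = y - v" if "y \<in> W" for y
  proof -
    have "\<rho> y ^ D = exp (of_nat D * (Ln ((y - v) / A) / of_nat D))"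
      unfolding \<rho>_def by (rule exp_of_nat_mult[symmetric])
    also have "\<dots> = (y - v) / A" using D A Wv[OF that] by simp
    finally show ?thesis using A by simp
  qed
  have \<rho>0: "\<rho> y \<noteq> 0" for y by (simp add: \<rho>_def)
  have fg: "f (g j y) = y" if "y \<in> W" for j y
    using \<rho>_pow[OF that] by (simp add: f_def g_def power_mult_distrib \<zeta>)
  have deriv: "(g j has_field_derivative g' j y) (at y)" if "y \<in> W" for j y
  proof -
    have "(y - v) / A \<notin> \<real>\<^sub>\<le>\<^sub>0" "A \<noteq> 0" "D > 0" using that A D by (simp_all add: W_def)
    hence "(g j has_field_derivative (\<zeta> j * (\<rho> y * (inverse ((y - v) / A) * (1 / A) / of_nat D)))) (at y)"
      unfolding g_def \<rho>_def by (auto intro!: derivative_eq_intros simp: divide_simps)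
    moreover have "\<zeta> j * (\<rho> y * (inverse ((y - v) / A) * (1 / A) / of_nat D)) = g' j y"
      using A Wv[OF that] D by (simp add: g'_def field_simps)
    ultimately show ?thesis by simp
  qed
  have fibre: "bij_betw (\<lambda>j. g j y) {..<D} {x. f x = y}" if y: "y \<in> W" for y
  proof -
    have "bij_betw \<zeta> {..<D} {z. z ^ D = 1}"
      unfolding \<zeta>_def by (rule Complex.bij_betw_roots_unity) (use D in simp)
    moreover have "bij_betw (\<lambda>z. c + z * \<rho> y) {z. z ^ D = 1} {x. f x = y}"
    proof (rule bij_betwI[where g = "\<lambda>x. (x - c) / \<rho> y"])
      show "(\<lambda>z. c + z * \<rho> y) \<in> {z. z ^ D = 1} \<rightarrow> {x. f x = y}"
        using \<rho>_pow[OF y] by (auto simp: f_def power_mult_distrib)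
      show "(\<lambda>x. (x - c) / \<rho> y) \<in> {x. f x = y} \<rightarrow> {z. z ^ D = 1}"
      proof
        fix x assume "x \<in> {x. f x = y}"
        hence "A * (x - c) ^ D = A * \<rho> y ^ D" using \<rho>_pow[OF y] by (auto simp: f_def)
        hence "(x - c) ^ D = \<rho> y ^ D" using A by simp
        thus "(x - c) / \<rho> y \<in> {z. z ^ D = 1}" using \<rho>0 by (simp add: power_divide)
      qed
    qed (use \<rho>0 in auto)
    ultimately have "bij_betw ((\<lambda>z. c + z * \<rho> y) \<circ> \<zeta>) {..<D} {x. f x = y}"
      by (rule bij_betw_trans)
    thus ?thesis by (simp add: o_def g_def)
  qed
  (* Here g' j is the derivative of the branch g j, that is 1 / f' at g j y. *)
  have pointwise: "norm \<mu> * F y \<le> (\<Sum>j<D. (norm (g' j y))\<^sup>2 * F (g j y))" if y: "y \<in> W" for y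
  proof -
    have "\<mu> * q y = (\<Sum>x | f x = y. q x / (of_nat D * A * (x - c) ^ (D - 1))\<^sup>2)"
      using y by (simp add: W_def E_def f_def)
    also have "\<dots> = (\<Sum>j<D. q (g j y) / (of_nat D * A * (g j y - c) ^ (D - 1))\<^sup>2)"
      by (rule sum.reindex_bij_betw[OF fibre[OF y], symmetric])
    also have "\<dots> = (\<Sum>j<D. (g' j y)\<^sup>2 * q (g j y))"
    proof (rule sum.cong)
      fix j
      have "(\<zeta> j * \<rho> y) ^ (D - 1) * (\<zeta> j * \<rho> y) = (\<zeta> j * \<rho> y) ^ D"
        using D by (intro power_minus_mult) simp
      also have "\<dots> = \<rho> y ^ D" by (simp add: power_mult_distrib \<zeta>)
      finally have "A * ((\<zeta> j * \<rho> y) ^ (D - 1) * (\<zeta> j * \<rho> y)) = y - v"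
        using \<rho>_pow[OF y] by simp
      note pow = this
      have s0: "\<zeta> j * \<rho> y \<noteq> 0" using \<rho>0 \<zeta> by simp
      have "of_nat D * A * (\<zeta> j * \<rho> y) ^ (D - 1) = of_nat D * (y - v) / (\<zeta> j * \<rho> y)"
        using nonzero_mult_div_cancel_right[OF s0, of "of_nat D * A * (\<zeta> j * \<rho> y) ^ (D - 1)"]
        by (simp only: pow[symmetric] mult.assoc)
      hence "1 / (of_nat D * A * (g j y - c) ^ (D - 1)) = g' j y"
        using \<rho>0 \<zeta> by (simp add: g_def g'_def)
      thus "q (g j y) / (of_nat D * A * (g j y - c) ^ (D - 1))\<^sup>2 = (g' j y)\<^sup>2 * q (g j y)"
        by (metis mult.commute power_one_over times_divide_eq_right mult.right_neutral)
    qed simp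
    finally have "norm \<mu> * F y = norm (\<Sum>j<D. (g' j y)\<^sup>2 * q (g j y))"
      by (simp add: F_def flip: norm_mult)
    also have "\<dots> \<le> (\<Sum>j<D. norm ((g' j y)\<^sup>2 * q (g j y)))" by (rule norm_sum)
    finally show ?thesis by (simp add: F_def norm_mult norm_power)
  qed
  have inj: "inj_on (g j) W" for j by (rule inj_on_inverseI) (rule fg)
  have Wleb: "W \<in> sets lebesgue" using openW by auto
  have im_leb: "g j ` W \<in> sets lebesgue" for j
  proof (rule differentiable_image_in_sets_lebesgue[OF Wleb])
    show "g j differentiable_on W"
      using deriv by (auto simp: differentiable_on_def has_field_derivative_def differentiable_def
          intro: has_derivative_at_withinI)
  qed simp
  have im_sub: "g j ` W \<subseteq> ball c (R / 2)" for j
  proof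
    fix x assume "x \<in> g j ` W"
    hence "f x \<in> W" using fg by auto
    hence "norm (f x - c) < R" by (simp add: W_def dist_norm norm_minus_commute)
    hence "norm (x - c) < R / 2" using expand[of x] by linarith
    thus "x \<in> ball c (R / 2)" by (simp add: dist_norm norm_minus_commute)
  qed
  have intF: "F absolutely_integrable_on ball c r" for r unfolding F_def by (rule int)
  have intFsub: "F absolutely_integrable_on S" if "S \<in> sets lebesgue" "S \<subseteq> ball c r" for S r
    by (rule set_integrable_subset[OF intF that])
  have cov: "(\<lambda>y. (norm (g' j y))\<^sup>2 * F (g j y)) absolutely_integrable_on W"
    "integral W (\<lambda>y. (norm (g' j y))\<^sup>2 * F (g j y)) = integral (g j ` W) F" for j
    using holomorphic_change_of_variables[OF openW deriv inj, of j F "integral (g j ` W) F"]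
      intFsub[OF im_leb im_sub, of j] by blast+
  have Wsub: "W \<subseteq> ball c R" by (auto simp: W_def)
  have F0: "F z \<ge> 0" for z by (simp add: F_def)
  have "integral (ball c R) F = integral W F"
  proof (rule integral_spike_set)
    have sub: "ball c R - W \<subseteq> {y. Im ((y - v) / A) = 0} \<union> E"
      by (auto simp: W_def complex_nonpos_Reals_iff)
    have "negligible ({y. Im ((y - v) / A) = 0} \<union> E)"
      using negligible_complex_line[OF A] negligible_finite[OF finE] by (simp add: negligible_Un)
    thus "negligible {x \<in> ball c R - W. F x \<noteq> 0}"
      by (rule negligible_subset) (use sub in auto)
    have "{x \<in> W - ball c R. F x \<noteq> 0} = {}" using Wsub by blast
    thus "negligible {x \<in> W - ball c R. F x \<noteq> 0}" by (simp only: negligible_empty)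
  qed
  also have "integral W F \<le> integral W (\<lambda>y. \<Sum>j<D. (norm (g' j y))\<^sup>2 * F (g j y))"
  proof (rule integral_le)
    show "F integrable_on W" using intFsub[OF Wleb Wsub] by (simp add: absolutely_integrable_on_def)
    show "(\<lambda>y. \<Sum>j<D. (norm (g' j y))\<^sup>2 * F (g j y)) integrable_on W"
      using cov(1) by (intro integrable_sum) (auto simp: absolutely_integrable_on_def)
    fix y assume "y \<in> W"
    have "F y \<le> norm \<mu> * F y" using \<mu> F0[of y] by (metis mult_le_cancel_right1 not_le)
    thus "F y \<le> (\<Sum>j<D. (norm (g' j y))\<^sup>2 * F (g j y))" using pointwise[OF \<open>y \<in> W\<close>] by linarith
  qed
  also have "\<dots> = (\<Sum>j<D. integral (g j ` W) F)"
    using cov by (subst integral_sum) (auto simp: absolutely_integrable_on_def)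
  also have "\<dots> = integral (\<Union>j<D. g j ` W) F"
  proof (rule integral_unique[symmetric], rule has_integral_UN)
    show "(F has_integral integral (g j ` W) F) (g j ` W)" for j
      using intFsub[OF im_leb im_sub, of j] by (simp add: absolutely_integrable_on_def integrable_integral)
    show "pairwise (\<lambda>i i'. negligible (g i ` W \<inter> g i' ` W)) {..<D}"
    proof (rule pairwiseI)
      fix i j assume ij: "i \<in> {..<D}" "j \<in> {..<D}" "i \<noteq> j"
      have "g i ` W \<inter> g j ` W = {}"
      proof (rule ccontr)
        assume "g i ` W \<inter> g j ` W \<noteq> {}"
        then obtain y y' where y: "y \<in> W" "y' \<in> W" "g i y = g j y'" by blast
        have "y = y'" using fg[OF y(1), of i] fg[OF y(2), of j] y(3) by simp
        thus False using bij_betw_imp_inj_on[OF fibre[OF y(1)]] ij y(3) by (auto simp: inj_on_def)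
      qed
      thus "negligible (g i ` W \<inter> g j ` W)" by (simp only: negligible_empty)
    qed
  qed simp
  also have "\<dots> \<le> integral (ball c (R / 2)) F"
  proof (rule integral_subset_le)
    show sub: "(\<Union>j<D. g j ` W) \<subseteq> ball c (R / 2)" using im_sub by blast
    have "(\<Union>j<D. g j ` W) \<in> sets lebesgue" using im_leb by (intro sets.finite_UN) auto
    from intFsub[OF this sub] show "F integrable_on (\<Union>j<D. g j ` W)"
      by (simp add: absolutely_integrable_on_def)
    show "F integrable_on ball c (R / 2)" using intF by (simp add: absolutely_integrable_on_def)
  qed (use F0 in auto)
  finally have le: "integral (ball c R) F \<le> integral (ball c (R / 2)) F" .
  (* The annulus between the two discs carries no mass, although it contains the disc below. *)
  define T where "T = ball c R - ball c (R / 2)"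
  have Tleb: "T \<in> sets lebesgue" by (auto simp: T_def)
  have intT: "F absolutely_integrable_on T" by (rule intFsub[OF Tleb]) (auto simp: T_def)
  have "((F has_integral (integral T F + integral (ball c (R / 2)) F)) (T \<union> ball c (R / 2)))"
  proof (rule has_integral_Un)
    have "T \<inter> ball c (R / 2) = {}" by (auto simp: T_def)
    thus "negligible (T \<inter> ball c (R / 2))" by (simp only: negligible_empty)
  qed (use intT intF[of "R / 2"] in \<open>auto simp: absolutely_integrable_on_def integrable_integral\<close>)
  moreover have "T \<union> ball c (R / 2) = ball c R" using R by (auto simp: T_def)
  ultimately have "integral (ball c R) F = integral T F + integral (ball c (R / 2)) F"
    by (simp add: integral_unique)
  hence "integral T F \<le> 0" using le by simp
  moreover have "integral T F \<ge> 0" using intT F0 by (intro integral_nonneg) (auto simp: absolutely_integrable_on_def)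
  ultimately have "integral T F = 0" by simp
  hence "(LINT x|lebesgue. indicator T x *\<^sub>R F x) = 0"
    using set_lebesgue_integral_eq_integral(2)[OF intT] by (simp add: set_lebesgue_integral_def)
  hence "AE x in lebesgue. indicator T x *\<^sub>R F x = 0"
    using intT unfolding set_integrable_def
    by (subst (asm) integral_nonneg_eq_0_iff_AE) (auto simp: F0)
  hence "negligible {x. indicator T x *\<^sub>R F x \<noteq> 0}"
    by (simp add: eventually_ae_filter_negligible) (meson negligible_subset subsetI mem_Collect_eq)
  hence "negligible ({x. indicator T x *\<^sub>R F x \<noteq> 0} \<union> {x. q x = 0})"
    using nonzero by (intro negligible_Un) (auto simp: eventually_cofinite intro: negligible_finite)
  moreover have "ball (c + of_real (3 * R / 4)) (R / 4) \<subseteq> {x. indicator T x *\<^sub>R F x \<noteq> 0} \<union> {x. q x = 0}"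
  proof
    fix x assume "x \<in> ball (c + of_real (3 * R / 4)) (R / 4)"
    hence x: "norm ((x - c) - of_real (3 * R / 4)) < R / 4"
      by (simp add: dist_norm norm_minus_commute algebra_simps)
    have "norm (of_real (3 * R / 4) :: complex) = 3 * R / 4" using R by (subst norm_of_real) simp
    hence "norm (x - c) < R" "norm (x - c) > R / 2"
      using x norm_triangle_sub[of "x - c" "of_real (3 * R / 4)"]
        norm_triangle_sub[of "of_real (3 * R / 4)" "x - c"] by (simp_all add: norm_minus_commute)
    hence "x \<in> T" by (simp add: T_def dist_norm norm_minus_commute)
    thus "x \<in> {x. indicator T x *\<^sub>R F x \<noteq> 0} \<union> {x. q x = 0}" by (auto simp: F_def)
  qed
  ultimately have "negligible (ball (c + of_real (3 * R / 4)) (R / 4))" by (rule negligible_subset)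
  thus False using open_not_negligible[of "ball (c + of_real (3 * R / 4)) (R / 4)"] R by auto
qed

section \<open>Residues of the pushforward\<close>

lemma linear_factor_quotient:
  fixes N :: "complex poly"
  assumes root: "poly N z = 0" and deg: "degree N \<le> n" "n > 0"
  obtains K where "N = [:-z, 1:] * K" "degree K < n" "coeff K (n - 1) = coeff N n"
proof -
  obtain K where K: "N = [:-z, 1:] * K" using root by (metis poly_eq_0_iff_dvd dvdE)
  have degK: "degree K < n"
  proof (cases "K = 0")
    case False
    hence "degree N = degree [:-z, 1:] + degree K" unfolding K by (intro degree_mult_eq) auto
    thus ?thesis using deg by simp
  qed (use deg in simp)
  obtain m where m: "n = Suc m" using deg(2) by (cases n) auto
  have "coeff N n = coeff K m" using degK by (simp add: K m coeff_eq_0)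
  thus ?thesis using that K degK by (simp add: m)
qed

text \<open>
  Lagrange interpolation at the roots of \<open>d\<close>, in the form \<open>fibre_sum_low_degree\<close>: on these roots
  \<open>p x / (z - x)\<close> agrees with the polynomial \<open>(p x * d z - p z * d x) / ((z - x) * d z)\<close> in \<open>x\<close>, whose
  degree is below that of \<open>d\<close>.
\<close>

lemma partial_fractions:
  fixes p d :: "complex poly"
  assumes deg: "degree p < degree d" and sqf: "rsquarefree d" and z: "poly d z \<noteq> 0"
  shows "poly p z / poly d z = (\<Sum>x | poly d x = 0. poly p x / poly (pderiv d) x / (z - x))"
proof -
  (* N vanishes at z, and its quotient by x - z is the interpolating polynomial up to a factor. *)
  define N where "N = Polynomial.smult (poly d z) p - Polynomial.smult (poly p z) d"
  have "degree N \<le> degree d"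
    unfolding N_def using deg by (intro degree_diff_le) (auto intro: order.trans[OF degree_smult_le])
  moreover have "poly N z = 0" by (simp add: N_def)
  ultimately obtain K where K: "N = [:-z, 1:] * K" "degree K < degree d"
      "coeff K (degree d - 1) = coeff N (degree d)"
    using linear_factor_quotient[of N z "degree d"] deg by auto
  have topN: "coeff N (degree d) = - poly p z * lead_coeff d"
    using deg by (simp add: N_def coeff_eq_0)
  have lc: "lead_coeff d \<noteq> 0" using deg by auto
  define h where "h = Polynomial.smult (- 1 / poly d z) K"
  have "degree h < degree d" using K(2) by (simp add: h_def)
  moreover have "poly (pderiv d) x \<noteq> 0" if "poly d x = 0" for x
    using sqf that by (auto simp: rsquarefree_roots)
  ultimately have "(\<Sum>x | poly d x = 0. poly h x / poly (pderiv d) x) = coeff h (degree d - 1) / lead_coeff d"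
    by (rule fibre_sum_low_degree)
  also have "\<dots> = poly p z / poly d z"
  proof -
    have "coeff h (degree d - 1) = - 1 / poly d z * (- poly p z * lead_coeff d)"
      by (simp only: h_def coeff_smult K(3) topN)
    thus ?thesis using lc by simp
  qed
  finally have "poly p z / poly d z = (\<Sum>x | poly d x = 0. poly h x / poly (pderiv d) x)" ..
  also have "\<dots> = (\<Sum>x | poly d x = 0. poly p x / poly (pderiv d) x / (z - x))"
  proof (rule sum.cong)
    fix x assume "x \<in> {x. poly d x = 0}"
    hence x: "poly d x = 0" by simp
    hence "x \<noteq> z" using z by auto
    have "poly d z * poly p x = (x - z) * poly K x"
      using arg_cong[OF K(1), of "\<lambda>p. poly p x"] x by (simp add: N_def algebra_simps)
    hence "poly h x = poly p x / (z - x)"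
      using z \<open>x \<noteq> z\<close> by (simp add: h_def field_simps)
    thus "poly h x / poly (pderiv d) x = poly p x / poly (pderiv d) x / (z - x)" by simp
  qed simp
  finally show ?thesis .
qed

text \<open>
  After clearing denominators, evaluation at \<open>z\<close> isolates the term of \<open>z\<close>.
\<close>

lemma simple_pole_coefficients_unique:
  fixes \<alpha> :: "complex \<Rightarrow> complex"
  assumes fin: "finite S" and zero: "\<forall>\<^sub>F y in cofinite. (\<Sum>x\<in>S. \<alpha> x / (y - x)) = 0"
    and z: "z \<in> S"
  shows "\<alpha> z = 0"
proof -
  define p where "p = (\<Sum>x\<in>S. Polynomial.smult (\<alpha> x) (\<Prod>x'\<in>S - {x}. [:-x', 1:]))"
  have "\<forall>\<^sub>F y in cofinite. y \<notin> S" using fin by (simp add: eventually_cofinite)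
  with zero have ev: "\<forall>\<^sub>F y in cofinite. poly p y = 0"
  proof eventually_elim
    case (elim y)
    have "poly p y = (\<Sum>x\<in>S. \<alpha> x / (y - x) * (\<Prod>x'\<in>S. y - x'))"
      unfolding p_def poly_sum
    proof (rule sum.cong)
      fix x assume x: "x \<in> S"
      have "(\<Prod>x'\<in>S. y - x') = (y - x) * (\<Prod>x'\<in>S - {x}. y - x')"
        by (rule prod.remove[OF fin x])
      moreover have "y - x \<noteq> 0" using x elim by auto
      ultimately show "poly (Polynomial.smult (\<alpha> x) (\<Prod>x'\<in>S - {x}. [:-x', 1:])) y = \<alpha> x / (y - x) * (\<Prod>x'\<in>S. y - x')"
        by (simp add: poly_prod)
    qed simp
    also have "\<dots> = (\<Sum>x\<in>S. \<alpha> x / (y - x)) * (\<Prod>x'\<in>S. y - x')" by (simp only: sum_distrib_right)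
    finally show ?case using elim by simp
  qed
  have "p = 0"
  proof (rule ccontr)
    assume "p \<noteq> 0"
    from eventually_poly_nonzero[OF this] ev have "\<forall>\<^sub>F y::complex in cofinite. False"
      by eventually_elim blast
    thus False by (simp add: eventually_cofinite infinite_UNIV_char_0)
  qed
  hence "0 = poly p z" by simp
  also have "\<dots> = (\<Sum>x\<in>S. if x = z then \<alpha> z * (\<Prod>x'\<in>S - {z}. z - x') else 0)"
    unfolding p_def poly_sum
  proof (rule sum.cong)
    fix x assume "x \<in> S"
    show "poly (Polynomial.smult (\<alpha> x) (\<Prod>x'\<in>S - {x}. [:-x', 1:])) z
        = (if x = z then \<alpha> z * (\<Prod>x'\<in>S - {z}. z - x') else 0)"
    proof (cases "x = z")
      case False
      hence "(\<Prod>x'\<in>S - {x}. z - x') = 0" using z fin by (intro prod_zero) auto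
      thus ?thesis using False by (simp add: poly_prod)
    qed (simp add: poly_prod)
  qed simp
  also have "\<dots> = \<alpha> z * (\<Prod>x'\<in>S - {z}. z - x')" using z fin by simp
  finally show ?thesis using fin by auto
qed

text \<open>
  The function \<open>a\<close> is the residue. There is at least one pole, because the condition at infinity makes
  the degree of the denominator exceed that of the numerator by 3 or more.
\<close>

lemma quad_diff_partial_fractions:
  assumes q: "q \<in> quad_diffs" "q \<noteq> 0"
  obtains a where "finite {x. a x \<noteq> 0}" "{x. a x \<noteq> 0} \<noteq> {}"
    "\<And>x. a x \<noteq> 0 \<Longrightarrow> rat_eval q x = 0"
    "\<And>z. a z = 0 \<Longrightarrow> rat_eval q z = (\<Sum>x | a x \<noteq> 0. a x / (z - x))"
proof -
  define p d where "p = rat_num q" and "d = rat_den q"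
  have d0: "d \<noteq> 0" by (simp add: d_def)
  have cop: "poly p x \<noteq> 0" if "poly d x = 0" for x
  proof
    assume "poly p x = 0"
    hence "[:-x, 1:] dvd p" "[:-x, 1:] dvd d" using that by (simp_all add: poly_eq_0_iff_dvd)
    hence "is_unit [:-x, 1:]" using coprime_rat_num_den[of q] unfolding p_def d_def coprime_def by blast
    thus False by (simp add: is_unit_iff_degree)
  qed
  have ord: "qd_order q x \<ge> -1" for x using q by (auto simp: quad_diffs_def)
  have deg: "degree p + 3 \<le> degree d"
    using q by (auto simp: quad_diffs_def qd_order_infinity_def p_def d_def)
  have "order x d = 0 \<or> order x d = 1" for x
  proof (cases "poly d x = 0")
    case True
    hence "order x p = 0" using cop by (intro order_0I) auto
    thus ?thesis using ord[of x] by (auto simp: qd_order_def p_def d_def)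
  qed (simp add: order_0I)
  hence sqf: "rsquarefree d" using d0 by (simp add: rsquarefree_def)
  define a where "a = (\<lambda>x. if poly d x = 0 then poly p x / poly (pderiv d) x else 0)"
  have a: "a x \<noteq> 0 \<longleftrightarrow> poly d x = 0" for x
    using sqf cop by (auto simp: a_def rsquarefree_roots)
  show ?thesis
  proof (rule that[of a])
    show "finite {x. a x \<noteq> 0}" unfolding a by (rule poly_roots_finite[OF d0])
    have "\<not> constant (poly d)" using deg by (simp add: constant_degree)
    thus "{x. a x \<noteq> 0} \<noteq> {}" unfolding a using fundamental_theorem_of_algebra by blast
    show "rat_eval q x = 0" if "a x \<noteq> 0" for x
      using that a by (simp add: rat_eval_def d_def)
    fix z assume "a z = 0"
    hence "poly d z \<noteq> 0" using a by blast
    hence "rat_eval q z = (\<Sum>x | poly d x = 0. poly p x / poly (pderiv d) x / (z - x))"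
      using partial_fractions[OF _ sqf, of p z] deg by (simp add: rat_eval_def p_def d_def)
    thus "rat_eval q z = (\<Sum>x | a x \<noteq> 0. a x / (z - x))"
      unfolding a by (simp add: a_def)
  qed
qed

lemma unicritical_normal_form:
  assumes deg: "degree f \<ge> 2" and uni: "unicritical f" and c: "poly (pderiv f) c = 0"
  obtains A where "A \<noteq> 0"
    "\<And>x. poly f x = A * (x - c) ^ degree f + poly f c"
    "\<And>x. poly (pderiv f) x = of_nat (degree f) * A * (x - c) ^ (degree f - 1)"
proof -
  define k m where "k = lead_coeff (pderiv f)" and "m = order c (pderiv f)"
  have roots: "{z. poly (pderiv f) z = 0} = {c}"
    using uni c by (auto simp: unicritical_def)
  have dec: "pderiv f = Polynomial.smult k ([:-c, 1:] ^ m)"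
    using complex_poly_decompose[of "pderiv f"]
    unfolding roots k_def[symmetric] by (simp add: m_def[symmetric])
  have "pderiv f \<noteq> 0" using deg by (simp add: pderiv_eq_0_iff)
  hence k0: "k \<noteq> 0" by (simp add: k_def)
  hence "degree (pderiv f) = m"
    by (simp add: dec Polynomial.degree_power_eq)
  hence D: "degree f = Suc m" using deg by (simp add: degree_pderiv)
  define A where "A = k / of_nat (Suc m)"
  define g where "g = Polynomial.smult A ([:-c, 1:] ^ Suc m)"
  have "pderiv g = Polynomial.smult (A * of_nat (Suc m)) ([:-c, 1:] ^ m)"
    by (simp add: g_def pderiv_smult pderiv_power_Suc pderiv_pCons del: power_Suc of_nat_Suc)
  also have "\<dots> = pderiv f" by (simp add: dec A_def del: of_nat_Suc)
  finally have "pderiv (f - g) = 0" by (simp add: pderiv_diff)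
  hence "degree (f - g) = 0" by (simp add: pderiv_eq_0_iff)
  then obtain t where t: "f - g = [:t:]" by (rule degree_eq_zeroE)
  have fx: "poly f x = A * (x - c) ^ Suc m + t" for x
    using arg_cong[OF t, of "\<lambda>p. poly p x"] by (simp add: g_def poly_power algebra_simps)
  show ?thesis
  proof (rule that[of A])
    show "A \<noteq> 0" using k0 by (simp add: A_def del: of_nat_Suc)
    show "poly f x = A * (x - c) ^ degree f + poly f c" for x
      using fx[of x] fx[of c] by (simp add: D)
    show "poly (pderiv f) x = of_nat (degree f) * A * (x - c) ^ (degree f - 1)" for x
      by (simp add: dec D A_def poly_power del: of_nat_Suc)
  qed
qed

text \<open>
  The hypothesis \<open>euler\<close> is the homogeneity of \<open>A * (z - c) ^ D\<close>. With it, on the fibre over \<open>y\<close>,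
  the function \<open>1 / ((x - a) * f' x)\<close> equals \<open>(1 + (a - c) / (x - a)) / (D * (y - v))\<close>, and \<open>1 / (x - a)\<close>
  equals the polynomial \<open>(f x - f a) / (x - a)\<close> divided by \<open>y - f a\<close>. So \<open>fibre_sum_low_degree\<close> evaluates the
  sum.
\<close>

lemma pushforward_simple_pole:
  fixes f :: "complex poly"
  assumes deg: "degree f \<ge> 2"
    and euler: "\<And>x. (x - c) * poly (pderiv f) x = of_nat (degree f) * (poly f x - v)"
    and y: "y \<noteq> v" "y \<noteq> poly f a"
  shows "(\<Sum>x | poly f x = y. 1 / (x - a) / (poly (pderiv f) x)\<^sup>2)
    = (a - c) / (of_nat (degree f) * (y - v) * (y - poly f a))"
proof -
  let ?n = "of_nat (degree f) :: complex"
  have n0: "?n \<noteq> 0" using deg by simp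
  have "degree (f - [:poly f a:]) \<le> degree f" by (intro degree_diff_le) auto
  then obtain K where K: "f - [:poly f a:] = [:-a, 1:] * K" "degree K < degree f"
      "coeff K (degree f - 1) = coeff (f - [:poly f a:]) (degree f)"
    using linear_factor_quotient[of "f - [:poly f a:]" a "degree f"] deg by auto
  have topK: "coeff K (degree f - 1) = lead_coeff f"
    using K(3) deg by (auto simp: coeff_pCons split: nat.splits)
  have lc: "lead_coeff f \<noteq> 0" using deg by auto
  define h where "h = Polynomial.smult (1 / (?n * (y - v))) (1 + Polynomial.smult ((a - c) / (y - poly f a)) K)"
  have "degree (1 + Polynomial.smult ((a - c) / (y - poly f a)) K) < degree f"
    using K(2) deg by (intro degree_add_less) (auto intro: le_less_trans[OF degree_smult_le])
  hence degh: "degree h < degree f"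
    unfolding h_def by (rule le_less_trans[OF degree_smult_le])
  have f'0: "poly (pderiv f) x \<noteq> 0" if "poly f x = y" for x
    using euler[of x] that n0 y(1) by auto
  have "(\<Sum>x | poly f x = y. 1 / (x - a) / (poly (pderiv f) x)\<^sup>2)
      = (\<Sum>x | poly f x = y. poly h x / poly (pderiv f) x)"
  proof (rule sum.cong)
    fix x assume "x \<in> {x. poly f x = y}"
    hence x: "poly f x = y" by simp
    define w where "w = poly (pderiv f) x"
    have w: "w \<noteq> 0" "(x - c) * w = ?n * (y - v)" using f'0[OF x] euler[of x] x by (simp_all add: w_def)
    have xa: "x - a \<noteq> 0" using x y(2) by auto
    have "y - poly f a = (x - a) * poly K x"
      using arg_cong[OF K(1), of "\<lambda>p. poly p x"] x by (simp add: algebra_simps)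
    moreover have "y - poly f a \<noteq> 0" using y(2) by simp
    ultimately have "poly K x / (y - poly f a) = 1 / (x - a)" using xa by (simp add: field_simps)
    moreover have "(a - c) / (y - poly f a) * poly K x = (a - c) * (poly K x / (y - poly f a))" by simp
    ultimately have "1 + (a - c) / (y - poly f a) * poly K x = 1 + (a - c) / (x - a)" by simp
    also have "\<dots> = (x - c) / (x - a)" using xa by (simp add: field_simps)
    finally have "poly h x = (x - c) / (x - a) / ((x - c) * w)"
      by (simp add: h_def w(2))
    moreover have "x - c \<noteq> 0" using w n0 y(1) by auto
    ultimately have "poly h x = 1 / (x - a) / w" by simp
    thus "1 / (x - a) / (poly (pderiv f) x)\<^sup>2 = poly h x / poly (pderiv f) x"
      by (simp add: w_def power2_eq_square)
  qed simp
  also have "\<dots> = coeff h (degree f - 1) / lead_coeff f"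
    using degh f'0 by (rule fibre_sum_low_degree)
  also have "coeff h (degree f - 1) = 1 / (?n * (y - v)) * ((a - c) / (y - poly f a) * lead_coeff f)"
    using topK deg by (simp add: h_def)
  finally show ?thesis using lc by simp
qed

text \<open>
  For \<open>x \<noteq> c\<close> the pushforward of \<open>1 / (z - x)\<close> splits as
  \<open>(1 / f' x) * (1 / (z - f x) - 1 / (z - v))\<close>, and the coefficients of simple poles are unique. The pole
  at \<open>c\<close> is pushed forward to 0, and its term \<open>a c / f' c\<close> is indeed 0, as a division by zero.
\<close>

lemma residue_equation:
  assumes deg: "degree f \<ge> 2"
    and euler: "\<And>x. (x - c) * poly (pderiv f) x = of_nat (degree f) * (poly f x - v)"
    and crit: "\<And>x. poly (pderiv f) x = 0 \<longleftrightarrow> x = c"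
    and fin: "finite {x. a x \<noteq> 0}"
    and q: "\<And>z. a z = 0 \<Longrightarrow> rat_eval q z = (\<Sum>x | a x \<noteq> 0. a x / (z - x))"
    and eigen: "\<forall>\<^sub>F y in cofinite. \<mu> * rat_eval q y
        = (\<Sum>x | poly f x = y. rat_eval q x / (poly (pderiv f) x)\<^sup>2)"
  shows "\<mu> * a z = (\<Sum>x | a x \<noteq> 0 \<and> poly f x = z. a x / poly (pderiv f) x)
     - (if z = v then \<Sum>x | a x \<noteq> 0. a x / poly (pderiv f) x else 0)"
proof -
  define X where "X = {x. a x \<noteq> 0}"
  define b where "b = (\<lambda>x. a x / poly (pderiv f) x)"
  define B where "B = sum b X"
  define r where "r = (\<lambda>z. \<Sum>x | x \<in> X \<and> poly f x = z. b x)"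
  define Z where "Z = insert z (insert v (X \<union> poly f ` X))"
  have finX: "finite X" using fin by (simp add: X_def)
  have finZ: "finite Z" using finX by (simp add: Z_def)
  have n0: "of_nat (degree f) \<noteq> (0::complex)" using deg by simp
  have "\<forall>\<^sub>F y in cofinite. y \<notin> Z" using finZ by (simp add: eventually_cofinite)
  moreover have "\<forall>\<^sub>F y in cofinite. \<forall>x. poly f x = y \<longrightarrow> x \<notin> X"
    by (rule eventually_fibre) (use finX in \<open>simp add: eventually_cofinite\<close>)
  ultimately have "\<forall>\<^sub>F y in cofinite.
      (\<Sum>x\<in>Z. (\<mu> * a x - (r x - (if x = v then B else 0))) / (y - x)) = 0"
    using eigen
  proof eventually_elim
    case (elim y)
    have "(\<Sum>x\<in>Z. \<mu> * a x / (y - x)) = (\<Sum>x\<in>X. \<mu> * a x / (y - x))"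
      by (rule sum.mono_neutral_right[OF finZ]) (auto simp: Z_def X_def)
    also have "\<dots> = \<mu> * (\<Sum>x\<in>X. a x / (y - x))" by (simp add: sum_distrib_left)
    also have "\<dots> = \<mu> * rat_eval q y"
    proof -
      have "a y = 0" using elim(1) by (auto simp: Z_def X_def)
      thus ?thesis by (simp add: q X_def)
    qed
    also have "\<dots> = (\<Sum>x | poly f x = y. (\<Sum>x'\<in>X. a x' / (x - x')) / (poly (pderiv f) x)\<^sup>2)"
      unfolding elim(3) using elim(2) q by (intro sum.cong) (auto simp: X_def)
    also have "\<dots> = (\<Sum>x | poly f x = y. \<Sum>x'\<in>X. a x' * (1 / (x - x') / (poly (pderiv f) x)\<^sup>2))"
      by (simp add: sum_divide_distrib)
    also have "\<dots> = (\<Sum>x'\<in>X. a x' * (\<Sum>x | poly f x = y. 1 / (x - x') / (poly (pderiv f) x)\<^sup>2))"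
      by (subst sum.swap) (simp add: sum_distrib_left)
    also have "\<dots> = (\<Sum>x'\<in>X. b x' * (1 / (y - poly f x') - 1 / (y - v)))"
    proof (rule sum.cong)
      fix x assume x: "x \<in> X"
      have y: "y \<noteq> v" "y \<noteq> poly f x" using elim(1) x by (auto simp: Z_def)
      have "a x * (\<Sum>x' | poly f x' = y. 1 / (x' - x) / (poly (pderiv f) x')\<^sup>2)
          = a x * ((x - c) / (of_nat (degree f) * (y - v) * (y - poly f x)))"
        by (simp only: pushforward_simple_pole[OF deg euler y])
      also have "\<dots> = b x * (1 / (y - poly f x) - 1 / (y - v))"
      proof (cases "x = c")
        case True
        thus ?thesis using crit by (simp add: b_def)
      next
        case False
        define w where "w = poly (pderiv f) x"
        have w: "poly f x - v = (x - c) * w / of_nat (degree f)"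
          using euler[of x] n0 by (simp add: w_def)
        have "w \<noteq> 0" using crit False by (simp add: w_def)
        have "1 / (y - poly f x) - 1 / (y - v) = (poly f x - v) / ((y - v) * (y - poly f x))"
          using y by (simp add: field_simps)
        also have "\<dots> = (x - c) * w / (of_nat (degree f) * (y - v) * (y - poly f x))"
          unfolding w by simp
        finally show ?thesis using \<open>w \<noteq> 0\<close> by (simp add: b_def w_def)
      qed
      finally show "a x * (\<Sum>x' | poly f x' = y. 1 / (x' - x) / (poly (pderiv f) x')\<^sup>2)
          = b x * (1 / (y - poly f x) - 1 / (y - v))" .
    qed simp
    also have "\<dots> = (\<Sum>x\<in>X. b x / (y - poly f x)) - B / (y - v)"
      by (simp add: right_diff_distrib sum_subtractf B_def sum_divide_distrib)
    also have "(\<Sum>x\<in>X. b x / (y - poly f x)) = (\<Sum>z\<in>Z. \<Sum>x | x \<in> X \<and> poly f x = z. b x / (y - poly f x))"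
      by (rule sum.group[symmetric, OF finX finZ]) (auto simp: Z_def)
    also have "\<dots> = (\<Sum>z\<in>Z. r z / (y - z))"
      unfolding r_def sum_divide_distrib by (intro sum.cong) auto
    also have "B / (y - v) = (\<Sum>z\<in>Z. (if z = v then B else 0) / (y - z))"
    proof -
      have "(\<Sum>z\<in>Z. (if z = v then B else 0) / (y - z)) = (\<Sum>z\<in>Z. if z = v then B / (y - v) else 0)"
        by (rule sum.cong) auto
      also have "\<dots> = B / (y - v)" using finZ by (simp add: Z_def)
      finally show ?thesis ..
    qed
    finally show ?case by (simp add: diff_divide_distrib sum_subtractf)
  qed
  from simple_pole_coefficients_unique[OF finZ this, of z]
  have "\<mu> * a z - (r z - (if z = v then B else 0)) = 0" by (simp add: Z_def)
  thus ?thesis by (simp add: r_def B_def b_def X_def)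
qed

text \<open>
  At a pole \<open>rat_eval\<close> is 0, so the sum of the terms \<open>\<bar>a x\<bar> / \<bar>z - x\<bar>\<close> is a bound everywhere.
\<close>

lemma rat_eval_absolutely_integrable:
  assumes fin: "finite {x. a x \<noteq> 0}"
    and pole: "\<And>x. a x \<noteq> 0 \<Longrightarrow> rat_eval q x = 0"
    and q: "\<And>z. a z = 0 \<Longrightarrow> rat_eval q z = (\<Sum>x | a x \<noteq> 0. a x / (z - x))"
  shows "(\<lambda>z. norm (rat_eval q z)) absolutely_integrable_on ball c R"
proof (rule measurable_bounded_by_integrable_imp_absolutely_integrable)
  let ?g = "\<lambda>z. \<Sum>x | a x \<noteq> 0. norm (a x) * (1 / norm (z - x))"
  have [measurable]: "poly p \<in> borel_measurable borel" for p :: "complex poly"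
    by (intro borel_measurable_continuous_onI continuous_intros)
  have "(\<lambda>z. norm (rat_eval q z)) \<in> borel_measurable borel"
    unfolding rat_eval_def by measurable
  hence "(\<lambda>z. norm (rat_eval q z)) \<in> borel_measurable lebesgue"
    by (simp add: measurable_completion)
  thus "(\<lambda>z. norm (rat_eval q z)) \<in> borel_measurable (lebesgue_on (ball c R))"
    by (rule measurable_restrict_space1)
  have "(\<lambda>z. 1 / norm (z - x)) integrable_on ball c R" for x
  proof -
    have "ball c R \<subseteq> ball x (R + dist c x)"
    proof
      fix w assume "w \<in> ball c R"
      thus "w \<in> ball x (R + dist c x)" using dist_triangle[of x w c] by (simp add: dist_commute)
    qed
    hence "(\<lambda>z. 1 / norm (z - x)) absolutely_integrable_on ball c R"
      by (intro set_integrable_subset[OF absolutely_integrable_inverse_norm]) auto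
    thus ?thesis by (simp add: absolutely_integrable_on_def)
  qed
  thus "?g integrable_on ball c R"
    by (intro integrable_sum fin integrable_on_mult_right)
  show "norm (norm (rat_eval q z)) \<le> ?g z" for z
  proof (cases "a z = 0")
    case True
    thus ?thesis using norm_sum[of "\<lambda>x. a x / (z - x)" "{x. a x \<noteq> 0}"] q[OF True]
      by (simp add: norm_divide)
  next
    case False
    thus ?thesis using pole[OF False] by (simp add: sum_nonneg)
  qed
qed auto

section \<open>Eigenvectors and orbits of poles\<close>

lemma inj_on_finite_periodic:
  assumes fin: "finite S" and maps: "g ` S \<subseteq> S" and inj: "inj_on g S" and x: "x \<in> S"
  shows "periodic_point g x"
proof -
  have stays: "(g ^^ k) y \<in> S" if "y \<in> S" for k y
    using that maps by (induction k) auto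
  have inj_k: "inj_on (g ^^ k) S" for k
  proof (induction k)
    case (Suc k)
    show ?case
    proof (rule inj_onI)
      fix y z assume yz: "y \<in> S" "z \<in> S" "(g ^^ Suc k) y = (g ^^ Suc k) z"
      hence "(g ^^ k) y = (g ^^ k) z" using inj stays by (auto dest: inj_onD)
      thus "y = z" using Suc.IH yz by (auto dest: inj_onD)
    qed
  qed simp
  have "finite (range (\<lambda>k. (g ^^ k) x))"
    by (rule finite_subset[OF _ fin]) (use stays[OF x] in auto)
  hence "\<not> inj (\<lambda>k. (g ^^ k) x)" using finite_imageD[of "\<lambda>k. (g ^^ k) x" UNIV] by auto
  then obtain i j where ij: "i < j" "(g ^^ i) x = (g ^^ j) x"
    unfolding inj_on_def by (metis linorder_neqE_nat)
  have "(g ^^ i) x = (g ^^ i) ((g ^^ (j - i)) x)"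
    using ij by (metis comp_apply funpow_add le_add_diff_inverse less_imp_le)
  hence "x = (g ^^ (j - i)) x" using inj_onD[OF inj_k] x stays[OF x] by metis
  thus ?thesis using ij(1) unfolding periodic_point_def by (intro exI[of _ "j - i"]) auto
qed

text \<open>
  For \<open>P\<close> the orbit of \<open>c\<close>, let \<open>S\<close> be the set of poles off \<open>P\<close>. A nonzero residue at a point of
  \<open>S\<close> must come from a pole in its fibre, and that pole is off \<open>P\<close> too. So \<open>g\<close> maps the finite set \<open>S\<close> onto
  a set containing \<open>S\<close>, hence permutes it, and the recursion for the residues has a single term. In its product over
  \<open>S\<close> the residues cancel.
\<close>

lemma poles_off_critical_orbit:
  fixes a u :: "complex \<Rightarrow> complex"
  assumes fin: "finite {x. a x \<noteq> 0}" and \<mu>: "\<mu> \<noteq> 0"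
    and rel: "\<And>z. z \<notin> P \<Longrightarrow> \<mu> * a z = (\<Sum>x | a x \<noteq> 0 \<and> g x = z. a x / (N * u x))"
    and P: "g ` P \<subseteq> P" and off: "{x. a x \<noteq> 0} - P \<noteq> {}"
  obtains S where "finite S" "S \<noteq> {}" "S \<inter> P = {}" "\<And>x. x \<in> S \<Longrightarrow> periodic_point g x"
    "(N * \<mu>) ^ card S * (\<Prod>x\<in>S. u x) = 1"
proof -
  define S where "S = {x. a x \<noteq> 0} - P"
  have finS: "finite S" unfolding S_def using fin by (rule finite_Diff)
  have "S \<subseteq> g ` S"
  proof
    fix z assume z: "z \<in> S"
    hence zP: "z \<notin> P" and "\<mu> * a z \<noteq> 0" using \<mu> by (simp_all add: S_def)
    hence "(\<Sum>x | a x \<noteq> 0 \<and> g x = z. a x / (N * u x)) \<noteq> 0" unfolding rel[OF zP] by blast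
    then obtain x where x: "a x \<noteq> 0" "g x = z"
      by (rule sum.not_neutral_contains_not_neutral) blast
    hence "x \<in> S" using P z by (auto simp: S_def)
    thus "z \<in> g ` S" using x by blast
  qed
  hence inj: "inj_on g S" using finS by (simp add: finite_surj_inj)
  hence "card (g ` S) = card S" by (rule card_image)
  hence gS: "g ` S = S" using \<open>S \<subseteq> g ` S\<close> finS by (metis card_subset_eq finite_imageI)
  have step: "\<mu> * a (g x) = a x / (N * u x)" if x: "x \<in> S" for x
  proof -
    have gx: "g x \<in> S" using gS x by blast
    have single: "{x'. a x' \<noteq> 0 \<and> g x' = g x} = {x}"
    proof (intro equalityI subsetI)
      fix x' assume x': "x' \<in> {x'. a x' \<noteq> 0 \<and> g x' = g x}"
      hence "x' \<in> S" using gx P by (auto simp: S_def)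
      thus "x' \<in> {x}" using inj x x' by (auto dest: inj_onD)
    qed (use x in \<open>auto simp: S_def\<close>)
    have "g x \<notin> P" using gx by (simp add: S_def)
    from rel[OF this] show ?thesis unfolding single by simp
  qed
  have a0: "a x \<noteq> 0" if "x \<in> S" for x using that by (simp add: S_def)
  have Nu: "N * u x \<noteq> 0" if "x \<in> S" for x
  proof -
    have "g x \<in> S" using gS that by blast
    thus ?thesis using step[OF that] \<mu> a0[of "g x"] by auto
  qed
  have "(N * \<mu>) ^ card S * (\<Prod>x\<in>S. u x) * (\<Prod>x\<in>S. a x)
      = (\<Prod>x\<in>S. (N * \<mu>) * u x) * (\<Prod>x\<in>S. a (g x))"
    using prod.reindex[OF inj, of a] gS by (simp add: prod.distrib)
  also have "\<dots> = (\<Prod>x\<in>S. (N * u x) * (\<mu> * a (g x)))"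
    by (simp add: prod.distrib[symmetric] mult_ac)
  also have "\<dots> = (\<Prod>x\<in>S. a x)"
    by (rule prod.cong) (use step Nu in auto)
  finally have "(N * \<mu>) ^ card S * (\<Prod>x\<in>S. u x) = 1" using a0 finS by simp
  moreover have "periodic_point g x" if "x \<in> S" for x
    using inj_on_finite_periodic[OF finS _ inj that] gS by simp
  moreover have "S \<noteq> {}" "S \<inter> P = {}" using off by (auto simp: S_def)
  ultimately show ?thesis using that finS by blast
qed

text \<open>
  With \<open>w k\<close> the \<open>(k + 1)\<close>-st point of the orbit and \<open>m + 1\<close> the exact period, each point except \<open>w 0 = g c\<close>
  has exactly one preimage on the orbit, so the residue at \<open>w (k + 1)\<close> is a multiple of the one at \<open>w k\<close>. The relation
  at \<open>g c\<close> then says that the residues sum to zero.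
\<close>

lemma poles_on_critical_orbit:
  fixes a u :: "complex \<Rightarrow> complex"
  assumes supp: "{x. a x \<noteq> 0} \<subseteq> range (\<lambda>k. (g ^^ k) c)" "{x. a x \<noteq> 0} \<noteq> {}"
    and \<mu>: "\<mu> \<noteq> 0"
    and per: "periodic_point g c" and fibre: "\<And>x. g x = g c \<Longrightarrow> x = c" and uc: "u c = 0"
    and rel: "\<And>z. \<mu> * a z = (\<Sum>x | a x \<noteq> 0 \<and> g x = z. a x / (N * u x))
       - (if z = g c then \<Sum>x | a x \<noteq> 0. a x / (N * u x) else 0)"
  obtains m w where "\<And>k. k < m \<Longrightarrow> periodic_point g (w k) \<and> w k \<noteq> c"
    "(\<Sum>k\<le>m. (1 / (N * \<mu>)) ^ k / (\<Prod>i<k. u (w i))) = 0"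
proof -
  define n where "n = (LEAST n. n > 0 \<and> (g ^^ n) c = c)"
  have "\<exists>n. n > 0 \<and> (g ^^ n) c = c" using per by (simp add: periodic_point_def)
  from LeastI_ex[OF this] have n: "n > 0" "(g ^^ n) c = c" by (simp_all add: n_def)
  have least: "(g ^^ k) c \<noteq> c" if "0 < k" "k < n" for k
    using that not_less_Least[of k "\<lambda>n. n > 0 \<and> (g ^^ n) c = c"] by (auto simp: n_def)
  obtain m where m: "n = Suc m" using n(1) by (cases n) auto
  define w where "w = (\<lambda>k. (g ^^ Suc k) c)"
  have wS: "g (w k) = w (Suc k)" for k by (simp add: w_def)
  have w0: "w 0 = g c" by (simp add: w_def)
  have wm: "w m = c" using n(2) by (simp add: w_def m)
  have perw: "periodic_point g (w k)" for k
    by (induction k) (auto simp: w0 wS[symmetric] intro: periodic_point_image per)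
  have wc: "w k \<noteq> c" if "k < m" for k using least[of "Suc k"] that by (simp add: w_def m)
  have inj: "inj_on w {..m}"
  proof (rule linorder_inj_onI)
    fix i j assume ij: "i < j" "i \<in> {..m}" "j \<in> {..m}"
    show "w i \<noteq> w j"
    proof
      assume eq: "w i = w j"
      (* If two points of the orbit agreed, so would their images, and c would recur too early. *)
      have shift: "w (k + l) = (g ^^ l) (w k)" for k l
        by (induction l) (auto simp: wS[symmetric])
      have "w (i + (m - j)) = w (j + (m - j))" by (simp only: shift eq)
      hence "w (i + (m - j)) = c" using ij wm by simp
      moreover have "i + (m - j) < m" using ij by auto
      ultimately show False using wc by blast
    qed
  qed auto
  have w_range: "x \<in> w ` {..m}" if "a x \<noteq> 0" for x
  proof -
    have "x \<in> range (\<lambda>k. (g ^^ k) c)" using that supp(1) by blast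
    then obtain k where k: "x = (g ^^ k) c" by blast
    have mod: "(g ^^ k) c = (g ^^ (k mod n)) c"
    proof -
      have "(g ^^ (n * i)) c = c" for i
        by (induction i) (auto simp: funpow_add n(2))
      hence "(g ^^ (k mod n + n * (k div n))) c = (g ^^ (k mod n)) c"
        by (simp only: funpow_add o_apply)
      thus ?thesis by simp
    qed
    show ?thesis
    proof (cases "k mod n")
      case 0
      thus ?thesis using k mod wm by (intro image_eqI[of _ _ m]) auto
    next
      case (Suc l)
      hence "l \<le> m" using mod_less_divisor[OF n(1), of k] by (simp add: m)
      thus ?thesis using k mod Suc by (intro image_eqI[of _ _ l]) (auto simp: w_def)
    qed
  qed
  let ?b = "\<lambda>x. a x / (N * u x)"
  have step: "\<mu> * a (w (Suc k)) = ?b (w k)" if k: "k < m" for k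
  proof -
    have uniq: "x = w k" if x: "a x \<noteq> 0" "g x = w (Suc k)" for x
    proof -
      obtain j where j: "j \<le> m" "x = w j" using w_range[OF x(1)] by auto
      show ?thesis
      proof (cases "j = m")
        case True
        hence "w 0 = w (Suc k)" using j x wm w0 by simp
        thus ?thesis using inj_onD[OF inj, of 0 "Suc k"] k by simp
      next
        case False
        hence "w (Suc j) = w (Suc k)" using j x wS by simp
        thus ?thesis using inj_onD[OF inj, of "Suc j" "Suc k"] k j False by simp
      qed
    qed
    have "(\<Sum>x | a x \<noteq> 0 \<and> g x = w (Suc k). ?b x) = ?b (w k)"
    proof (cases "a (w k) = 0")
      case True
      hence empty: "{x. a x \<noteq> 0 \<and> g x = w (Suc k)} = {}" using uniq by blast
      show ?thesis unfolding empty using True by simp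
    next
      case False
      hence single: "{x. a x \<noteq> 0 \<and> g x = w (Suc k)} = {w k}" using uniq wS by blast
      show ?thesis unfolding single by simp
    qed
    moreover have "w (Suc k) \<noteq> g c" using inj_onD[OF inj, of "Suc k" 0] k w0 by auto
    ultimately show ?thesis using rel[of "w (Suc k)"] by simp
  qed
  have sum0: "(\<Sum>k\<le>m. a (w k)) = 0"
  proof -
    have "(\<Sum>x | a x \<noteq> 0 \<and> g x = g c. ?b x) = 0"
      by (rule sum.neutral) (use fibre uc in auto)
    hence "\<mu> * a (w 0) = - (\<Sum>x | a x \<noteq> 0. ?b x)" using rel[of "g c"] by (simp add: w0)
    also have "(\<Sum>x | a x \<noteq> 0. ?b x) = (\<Sum>x\<in>w ` {..m}. ?b x)"
      by (rule sum.mono_neutral_left) (use w_range in auto)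
    also have "\<dots> = (\<Sum>k\<le>m. ?b (w k))" by (rule sum.reindex[OF inj, unfolded o_def])
    also have "\<dots> = (\<Sum>k<m. ?b (w k))" by (simp add: lessThan_Suc_atMost[symmetric] wm uc)
    also have "\<dots> = (\<Sum>k<m. \<mu> * a (w (Suc k)))" by (rule sum.cong) (auto simp: step)
    finally have "\<mu> * (a (w 0) + (\<Sum>k<m. a (w (Suc k)))) = 0"
      by (simp add: ring_distribs sum_distrib_left)
    hence "a (w 0) + (\<Sum>k<m. a (w (Suc k))) = 0" using \<mu> by simp
    thus ?thesis by (simp only: lessThan_Suc_atMost[symmetric] sum.lessThan_Suc_shift)
  qed
  define t where "t = 1 / (N * \<mu>)"
  have closed: "a (w k) = a (w 0) * (t ^ k / (\<Prod>i<k. u (w i)))" if "k \<le> m" for k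
    using that
  proof (induction k)
    case (Suc k)
    have "a (w (Suc k)) = ?b (w k) / \<mu>" using step[of k] Suc.prems \<mu> by (metis Suc_le_lessD nonzero_mult_div_cancel_left)
    also have "\<dots> = a (w k) * (t / u (w k))" by (simp add: t_def)
    also have "\<dots> = a (w 0) * (t ^ Suc k / (\<Prod>i<Suc k. u (w i)))"
      using Suc by simp
    finally show ?case .
  qed simp
  have "a (w 0) \<noteq> 0"
  proof
    assume "a (w 0) = 0"
    hence "a (w k) = 0" if "k \<le> m" for k using closed[OF that] by simp
    thus False using supp(2) w_range by auto
  qed
  moreover have "a (w 0) * (\<Sum>k\<le>m. t ^ k / (\<Prod>i<k. u (w i))) = 0"
  proof -
    have "(\<Sum>k\<le>m. a (w k)) = (\<Sum>k\<le>m. a (w 0) * (t ^ k / (\<Prod>i<k. u (w i))))"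
      by (rule sum.cong[OF refl], rule closed) simp
    thus ?thesis unfolding sum_distrib_left using sum0 by simp
  qed
  ultimately have "(\<Sum>k\<le>m. t ^ k / (\<Prod>i<k. u (w i))) = 0" by simp
  thus ?thesis using that[of m w] perw wc by (simp add: t_def)
qed

lemma rat_eval_qd_scale:
  "\<forall>\<^sub>F y in cofinite. rat_eval (qd_scale \<mu> q) y = \<mu> * rat_eval q y"
  using eventually_poly_nonzero[OF rat_den_nonzero[of q]]
proof eventually_elim
  case (elim y)
  have "qd_scale \<mu> q = Fract ([:\<mu>:] * rat_num q) (rat_den q)"
    unfolding qd_scale_def by (subst Fract_rat_num_den[of q, symmetric]) (simp add: to_fract_def)
  thus ?case using rat_eval_Fract[OF elim, of "[:\<mu>:] * rat_num q"] by (simp add: rat_eval_def)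
qed

theorem theorem3:
  fixes D :: nat and f :: "complex poly" and c \<mu> :: complex
  assumes "D \<ge> 2" and "degree f = D"
    and "unicritical f"
    and "poly (pderiv f) c = 0" and "periodic_point (poly f) c"
    and "pushforward_eigenvalue f \<mu>" and "\<mu> \<noteq> 0"
  shows "algebraic_unit (of_nat D * \<mu>) \<and> 1 / (4 * real D) < cmod \<mu> \<and> cmod \<mu> < 1"
proof -
  have deg: "degree f \<ge> 2" using assms(1,2) by simp
  obtain A where A: "A \<noteq> 0"
    and f: "\<And>x. poly f x = A * (x - c) ^ D + poly f c"
    and f': "\<And>x. poly (pderiv f) x = of_nat D * A * (x - c) ^ (D - 1)"
    using unicritical_normal_form[OF deg assms(3,4)] assms(2) by auto
  define u where "u = (\<lambda>x. A * (x - c) ^ (D - 1))"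
  have f'u: "poly (pderiv f) x = of_nat D * u x" for x by (simp add: f' u_def)
  have D0: "of_nat D \<noteq> (0 :: complex)" using assms(1) by simp
  obtain q where q: "q \<in> quad_diffs" "q \<noteq> 0" "pushforward f q = qd_scale \<mu> q"
    using assms(6) by (auto simp: pushforward_eigenvalue_def)
  have eigen: "\<forall>\<^sub>F y in cofinite. \<mu> * rat_eval q y
      = (\<Sum>x | poly f x = y. rat_eval q x / (poly (pderiv f) x)\<^sup>2)"
    using pushforward_spec[of f q] rat_eval_qd_scale[of \<mu> q] deg
    unfolding q(3) by (auto elim: eventually_elim2)
  obtain a where a: "finite {x. a x \<noteq> 0}" "{x. a x \<noteq> 0} \<noteq> {}"
      "\<And>x. a x \<noteq> 0 \<Longrightarrow> rat_eval q x = 0"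
      "\<And>z. a z = 0 \<Longrightarrow> rat_eval q z = (\<Sum>x | a x \<noteq> 0. a x / (z - x))"
    by (rule quad_diff_partial_fractions[OF q(1,2)]) blast
  have less1: "cmod \<mu> < 1"
  proof (rule norm_less_one_of_L1_contraction[OF assms(1) A])
    show "(\<lambda>z. cmod (rat_eval q z)) absolutely_integrable_on ball c R" for R
      by (rule rat_eval_absolutely_integrable[OF a(1,3,4)])
    show "\<forall>\<^sub>F y in cofinite. \<mu> * rat_eval q y = (\<Sum>x | A * (x - c) ^ D + poly f c = y.
        rat_eval q x / (of_nat D * A * (x - c) ^ (D - 1))\<^sup>2)"
      using eigen unfolding f' by (simp only: f[symmetric])
    have "rat_num q \<noteq> 0"
    proof
      assume "rat_num q = 0"
      moreover have "Fract 0 (rat_den q) = 0" by (simp add: Zero_fract_def eq_fract)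
      ultimately show False using q(2) Fract_rat_num_den[of q] by simp
    qed
    from eventually_poly_nonzero[OF this] eventually_poly_nonzero[OF rat_den_nonzero[of q]]
    show "\<forall>\<^sub>F z in cofinite. rat_eval q z \<noteq> 0"
      by eventually_elim (simp add: rat_eval_def)
  qed
  have euler: "(x - c) * poly (pderiv f) x = of_nat (degree f) * (poly f x - poly f c)" for x
  proof -
    have "(x - c) ^ (D - 1) * (x - c) = (x - c) ^ D" using assms(1) by (intro power_minus_mult) simp
    thus ?thesis using f[of x] assms(2) by (simp add: f' mult_ac)
  qed
  have crit: "poly (pderiv f) x = 0 \<longleftrightarrow> x = c" for x
    using A D0 assms(1) by (simp add: f')
  note rel = residue_equation[OF deg euler crit a(1,4) eigen, unfolded f'u]
  have fibre: "x = c" if "poly f x = poly f c" for x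
    using that f[of x] A by simp
  have mult: "norm (u x) \<le> 2" "x \<noteq> c \<Longrightarrow> algebraic_unit (u x)" if "periodic_point (poly f) x" for x
    using unicritical_periodic_derivative[OF assms(1) A f assms(5) that] unfolding u_def by blast+
  define P where "P = range (\<lambda>k. (poly f ^^ k) c)"
  have P: "poly f ` P \<subseteq> P"
  proof
    fix y assume "y \<in> poly f ` P"
    then obtain k where "y = (poly f ^^ Suc k) c" by (auto simp: P_def)
    thus "y \<in> P" unfolding P_def by (rule range_eqI)
  qed
  have "c \<in> P" unfolding P_def by (rule range_eqI[of _ _ 0]) simp
  hence cv: "poly f c \<in> P" using P by blast
  have "algebraic_unit (of_nat D * \<mu>) \<and> norm (of_nat D * \<mu>) > 1 / 4"
  proof (cases "{x. a x \<noteq> 0} - P = {}")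
    case False
    have relP: "\<mu> * a z = (\<Sum>x | a x \<noteq> 0 \<and> poly f x = z. a x / (of_nat D * u x))" if "z \<notin> P" for z
      using rel[of z] that cv by auto
    from poles_off_critical_orbit[OF a(1) assms(7) relP P False]
    obtain S where S: "finite S" "S \<noteq> {}" "S \<inter> P = {}"
        "\<And>x. x \<in> S \<Longrightarrow> periodic_point (poly f) x"
        and prod: "(of_nat D * \<mu>) ^ card S * (\<Prod>x\<in>S. u x) = 1" by blast
    have card: "card S > 0" using S by (simp add: card_gt_0_iff)
    have "algebraic_unit (\<Prod>x\<in>S. u x)"
    proof (rule algebraic_unit_prod)
      fix x assume x: "x \<in> S"
      hence "x \<noteq> c" using S(3) \<open>c \<in> P\<close> by blast
      with S(4)[OF x] show "algebraic_unit (u x)" by (rule mult(2))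
    qed
    from algebraic_unit_inverse[OF this] have "algebraic_unit ((of_nat D * \<mu>) ^ card S)"
      using prod by (metis inverse_unique mult.commute)
    hence "algebraic_unit (of_nat D * \<mu>)" using card by (rule algebraic_unit_of_power)
    moreover have "norm (of_nat D * \<mu>) > 1 / 4"
    proof (rule ccontr)
      assume "\<not> norm (of_nat D * \<mu>) > 1 / 4"
      hence "norm (of_nat D * \<mu>) ^ card S \<le> (1 / 4) ^ card S" by (intro power_mono) auto
      moreover have "(\<Prod>x\<in>S. norm (u x)) \<le> (\<Prod>x\<in>S. 2)"
        using mult(1)[OF S(4)] by (intro prod_mono) simp
      ultimately have "norm (of_nat D * \<mu>) ^ card S * (\<Prod>x\<in>S. norm (u x)) \<le> (1 / 4) ^ card S * 2 ^ card S"
        by (intro mult_mono) (auto intro: prod_nonneg)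
      moreover have "norm (of_nat D * \<mu>) ^ card S * (\<Prod>x\<in>S. norm (u x)) = 1"
        using arg_cong[OF prod, of norm] by (simp only: norm_mult norm_power prod_norm norm_one)
      moreover have "(1 / 4 :: real) ^ card S * 2 ^ card S = (1 / 2) ^ card S"
        by (simp flip: power_mult_distrib)
      moreover have "(1 / 2 :: real) ^ card S < 1" using card by (simp add: power_less_one_iff)
      ultimately show False by simp
    qed
    ultimately show ?thesis by blast
  next
    case True
    hence sub: "{x. a x \<noteq> 0} \<subseteq> range (\<lambda>k. (poly f ^^ k) c)" by (auto simp: P_def)
    have uc: "u c = 0" using assms(1) by (simp add: u_def)
    obtain m w where w: "\<And>k. k < m \<Longrightarrow> periodic_point (poly f) (w k) \<and> w k \<noteq> c"
        "(\<Sum>k\<le>m. (1 / (of_nat D * \<mu>)) ^ k / (\<Prod>i<k. u (w i))) = 0"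
      using poles_on_critical_orbit[OF sub a(2) assms(7) assms(5) fibre uc rel] by blast
    have "1 / (of_nat D * \<mu>) \<noteq> 0" using D0 assms(7) by simp
    hence "algebraic_unit (1 / (of_nat D * \<mu>))" "norm (1 / (of_nat D * \<mu>)) < 4"
      using unit_series_root[of m "\<lambda>k. u (w k)" "1 / (of_nat D * \<mu>)"] w(1) mult w(2) by simp_all
    moreover have "norm (of_nat D * \<mu>) > 0" using D0 assms(7) by simp
    ultimately show ?thesis
      using algebraic_unit_inverse[of "1 / (of_nat D * \<mu>)"]
      by (simp add: norm_divide field_simps)
  qed
  moreover have "real D > 0" using assms(1) by simp
  ultimately show ?thesis using less1 by (auto simp: norm_mult field_simps)
qed

end
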